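(* Let $B_1$ and $B_2$ be two Blaschke products on the unit disc $\mathbb{D}$, and let $H_i=\mathrm{H}^2\ominus B_i\mathrm{H}^2$, $i=1,2$, be their model spaces. (i) Let $0<\varepsilon<1$. If \[ \inf_{z\in\mathbb{D}}\max\{|B_1(z)|,|B_2(z)|\}\leq\varepsilon, \] then there exist $x_1\in H_1$ and $x_2\in H_2$ such that $\|x_i\|\geq\sqrt{1-\varepsilon^2}$ for $i=1,2$ and $\|x_1-x_2\|\leq 2\varepsilon$. (ii) For every $\delta>0$ there exists a constant $c_\delta>0$, depending only on $\delta$, such that if \[ \inf_{z\in\mathbb{D}}\max\{|B_1(z)|,|B_2(z)|\}\geq\delta, \] then $\sin(H_1,H_2)>c_\delta$.
   Context: $\mathrm{H}^2$ is the Hardy space of the unit disc $\mathbb{D}$, with its usual norm. For closed subspaces $L,K$ of a Hilbert space, $\sin(L,K):=\inf\{\mathrm{dist}(k,L)\mid k\in K,\ \|k\|=1\}$. Blaschke products may be finite or infinite. *)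

theory Defs
  imports "HOL-Complex_Analysis.Complex_Analysis"
begin

text \<open>
  Elements of the Hardy space are represented by total functions \<open>complex \<Rightarrow> complex\<close>, of which only
  the restriction to the open unit disc matters: membership, inner product and norm depend on the
  values in the disc only. The norm and the inner product are those of the sequence of
  Taylor coefficients at \<open>0\<close>.
\<close>

definition hardy_coeff :: "(complex \<Rightarrow> complex) \<Rightarrow> nat \<Rightarrow> complex" where
  "hardy_coeff f n = fps_nth (fps_expansion f 0) n"

definition hardy_space :: "(complex \<Rightarrow> complex) set" where
  "hardy_space = {f. f holomorphic_on ball 0 1 \<and> summable (\<lambda>n. (cmod (hardy_coeff f n))\<^sup>2)}"

definition hardy_inner :: "(complex \<Rightarrow> complex) \<Rightarrow> (complex \<Rightarrow> complex) \<Rightarrow> complex" where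
  "hardy_inner f g = (\<Sum>n. hardy_coeff f n * cnj (hardy_coeff g n))"

definition hardy_norm :: "(complex \<Rightarrow> complex) \<Rightarrow> real" where
  "hardy_norm f = sqrt (\<Sum>n. (cmod (hardy_coeff f n))\<^sup>2)"

definition blaschke_factor :: "complex \<Rightarrow> complex \<Rightarrow> complex" where
  "blaschke_factor a z =
     (if a = 0 then z else of_real (cmod a) / a * ((a - z) / (1 - cnj a * z)))"

text \<open>
  The zeros, repeated according to multiplicity, are \<open>a n\<close> for \<open>n \<in> I\<close>. A finite \<open>I\<close> gives a finite
  Blaschke product (a unimodular constant if \<open>I\<close> is empty). The summability condition is the
  Blaschke condition; it makes the infinite product converge throughout the disc, where
  \<^const>\<open>prodinf\<close> correctly yields \<open>0\<close> at the zeros. A unimodular constant factor is allowed.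
\<close>

definition blaschke_product :: "(complex \<Rightarrow> complex) \<Rightarrow> bool" where
  "blaschke_product B \<longleftrightarrow>
     (\<exists>(c::complex) (I::nat set) (a::nat \<Rightarrow> complex).
        cmod c = 1 \<and>
        (\<forall>n\<in>I. cmod (a n) < 1) \<and>
        (\<lambda>n. 1 - cmod (a n)) summable_on I \<and>
        (\<forall>z\<in>ball 0 1. B z = c * (\<Prod>n. if n \<in> I then blaschke_factor (a n) z else 1)))"

definition model_space :: "(complex \<Rightarrow> complex) \<Rightarrow> (complex \<Rightarrow> complex) set" where
  "model_space B = {f \<in> hardy_space. \<forall>g\<in>hardy_space. hardy_inner f (\<lambda>z. B z * g z) = 0}"

definition hardy_setdist :: "(complex \<Rightarrow> complex) \<Rightarrow> (complex \<Rightarrow> complex) set \<Rightarrow> real" where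
  "hardy_setdist k L = (INF h\<in>L. hardy_norm (\<lambda>z. k z - h z))"

text \<open>
  The outer infimum is taken in the extended reals, so that \<open>hardy_sin L K = \<infinity>\<close> (the infimum of
  the empty set) if \<open>K\<close> is the zero subspace.
\<close>

definition hardy_sin :: "(complex \<Rightarrow> complex) set \<Rightarrow> (complex \<Rightarrow> complex) set \<Rightarrow> ereal" where
  "hardy_sin L K = (INF k\<in>{k \<in> K. hardy_norm k = 1}. ereal (hardy_setdist k L))"

end

theory Submission
  imports Defs
begin

text \<open>
  (i) For the normalized reproducing kernel \<open>k\<close> at a point \<open>w\<close> and an inner \<open>B\<close>, the projection of
  \<open>k\<close> onto the model space is \<open>k - u\<close> with \<open>u = cnj (B w) B k\<close>, and \<open>\<langle>u, k\<rangle> = \<parallel>u\<parallel>\<^sup>2 = \<bar>B w\<bar>\<^sup>2\<close>. The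
  two vectors \<open>u\<^sub>1, u\<^sub>2\<close> have a common component along \<open>k\<close>, so \<open>\<parallel>u\<^sub>1 - u\<^sub>2\<parallel>\<close> is strictly smaller than the
  trivial bound; this slack absorbs the fact that the infimum over the disc need not be attained.

  (ii) This is the \<open>H\<^sup>2\<close> corona theorem for two functions, in the dual form
  \<open>\<parallel>k\<parallel>\<^sup>2 \<le> C (\<parallel>T\<^sub>1\<^sup>* k\<parallel>\<^sup>2 + \<parallel>T\<^sub>2\<^sup>* k\<parallel>\<^sup>2)\<close> for the adjoints of multiplication by \<open>B\<^sub>1, B\<^sub>2\<close>. By dilation
  and truncation all functions may be taken to be polynomials, so no boundary values are needed. On the circle \<open>P\<^sub>i cnj k = cnj p\<^sub>i + R\<^sub>i\<close> with
  \<open>p\<^sub>i = T\<^sub>i\<^sup>* k\<close> and \<open>R\<^sub>i 0 = 0\<close>, so \<open>\<parallel>k\<parallel>\<^sup>2\<close> is a term controlled by the \<open>p\<^sub>i\<close> plus the circle mean of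
  \<open>G = k (cnj P\<^sub>1 R\<^sub>1 + cnj P\<^sub>2 R\<^sub>2) / (\<bar>P\<^sub>1\<bar>\<^sup>2 + \<bar>P\<^sub>2\<bar>\<^sup>2)\<close>. As in Wolff's proof, the Laplacian of \<open>G\<close> only
  involves \<open>R = P\<^sub>2 R\<^sub>1 - P\<^sub>1 R\<^sub>2\<close>, which equals \<open>P\<^sub>1 cnj p\<^sub>2 - P\<^sub>2 cnj p\<^sub>1\<close> on the circle. It is dominated
  pointwise by the Laplacian of a sum \<open>V\<close> of squares \<open>\<bar>g\<bar>\<^sup>2\<close> of polynomials, and the sub-mean value
  property of \<open>V - Re (\<kappa> G)\<close> then replaces Green's formula and Carleson measure estimates.
\<close>

section \<open>Wirtinger derivatives and the sub-mean value property\<close>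

text \<open>\<open>a\<close> and \<open>b\<close> are the derivatives of \<open>X\<close> at \<open>z\<close> with respect to \<open>z\<close> and \<open>cnj z\<close>.\<close>

definition has_wirtinger :: "(complex \<Rightarrow> complex) \<Rightarrow> complex \<Rightarrow> complex \<Rightarrow> complex \<Rightarrow> bool" where
  "has_wirtinger X a b z \<longleftrightarrow> (X has_derivative (\<lambda>h. a * h + b * cnj h)) (at z)"

lemma has_wirtinger_const: "has_wirtinger (\<lambda>z. k) 0 0 z"
  by (simp add: has_wirtinger_def)

lemma has_wirtinger_holo: "(f has_field_derivative f') (at z) \<Longrightarrow> has_wirtinger f f' 0 z"
  by (simp add: has_wirtinger_def has_field_derivative_def)

lemma has_wirtinger_cnj: "has_wirtinger X a b z \<Longrightarrow> has_wirtinger (\<lambda>z. cnj (X z)) (cnj b) (cnj a) z"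
  unfolding has_wirtinger_def by (drule has_derivative_cnj) (simp add: add.commute)

lemma has_wirtinger_add: "has_wirtinger X a b z \<Longrightarrow> has_wirtinger Y c d z \<Longrightarrow> has_wirtinger (\<lambda>z. X z + Y z) (a + c) (b + d) z"
  unfolding has_wirtinger_def by (drule (1) has_derivative_add) (simp add: algebra_simps)

lemma has_wirtinger_mult:
  "has_wirtinger X a b z \<Longrightarrow> has_wirtinger Y c d z \<Longrightarrow>
     has_wirtinger (\<lambda>z. X z * Y z) (a * Y z + X z * c) (b * Y z + X z * d) z"
  unfolding has_wirtinger_def by (drule (1) has_derivative_mult) (simp add: algebra_simps)

lemma has_wirtinger_cmult: "has_wirtinger X a b z \<Longrightarrow> has_wirtinger (\<lambda>z. k * X z) (k * a) (k * b) z"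
  using has_wirtinger_mult[OF has_wirtinger_const, of X a b z k] by simp

lemma has_wirtinger_minus: "has_wirtinger X a b z \<Longrightarrow> has_wirtinger (\<lambda>z. - X z) (- a) (- b) z"
  using has_wirtinger_cmult[of X a b z "-1"] by simp

lemma has_wirtinger_diff: "has_wirtinger X a b z \<Longrightarrow> has_wirtinger Y c d z \<Longrightarrow> has_wirtinger (\<lambda>z. X z - Y z) (a - c) (b - d) z"
  using has_wirtinger_add[of X a b z "\<lambda>z. - Y z" "- c" "- d"] has_wirtinger_minus[of Y c d z] by simp

lemma has_wirtinger_inverse:
  assumes "has_wirtinger X a b z" "X z \<noteq> 0"
  shows "has_wirtinger (\<lambda>z. inverse (X z)) (- a / (X z)\<^sup>2) (- b / (X z)\<^sup>2) z"
  unfolding has_wirtinger_def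
  by (rule has_derivative_eq_rhs[OF Deriv.has_derivative_inverse[OF assms(2) assms(1)[unfolded has_wirtinger_def]]])
     (auto simp: fun_eq_iff power2_eq_square divide_inverse algebra_simps)

lemma has_wirtinger_eqI: "has_wirtinger X a b z \<Longrightarrow> a = a' \<Longrightarrow> b = b' \<Longrightarrow> has_wirtinger X a' b' z"
  by simp

section \<open>Integrals over circles and their dependence on the radius\<close>

definition cmean :: "(complex \<Rightarrow> complex) \<Rightarrow> complex" where
  "cmean F = integral {0..2*pi} (\<lambda>t. F (cis t)) / (2 * pi)"

lemma rcis_in_disc: "0 < r \<Longrightarrow> r < 1 \<Longrightarrow> complex_of_real r * cis t \<in> ball 0 1"
  by (simp add: norm_mult)

lemma circle_integral_derivative:
  assumes X: "\<And>z. z \<in> ball 0 1 \<Longrightarrow> has_wirtinger X (a z) (b z) z"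
    and ca: "continuous_on (ball 0 1) a" and cb: "continuous_on (ball 0 1) b"
    and r: "0 < r" "r < (1::real)"
  shows "((\<lambda>r. integral {0..2*pi} (\<lambda>t. X (of_real r * cis t))) has_vector_derivative
            2 * integral {0..2*pi} (\<lambda>t. a (of_real r * cis t) * cis t)) (at r)"
    and "integral {0..2*pi} (\<lambda>t. a (of_real r * cis t) * cis t)
       = integral {0..2*pi} (\<lambda>t. b (of_real r * cis t) * cnj (cis t))"
proof -
  let ?U = "{0<..<1::real}"
  have cX: "continuous_on (ball 0 1) X"
    using X unfolding has_wirtinger_def
    by (meson continuous_at_imp_continuous_on has_derivative_continuous)
  have cis_c: "continuous_on S (\<lambda>p. complex_of_real (fst p) * cis (snd p))" for S
    by (intro continuous_intros)
  have comp: "continuous_on (?U \<times> cbox 0 (2*pi)) (\<lambda>p. Y (complex_of_real (fst p) * cis (snd p)))"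
    if "continuous_on (ball 0 1) Y" for Y :: "complex \<Rightarrow> complex"
    by (rule continuous_on_compose2[OF that cis_c]) (auto simp: norm_mult)
  have comp1: "continuous_on T (\<lambda>t. Y (complex_of_real s * cis t))"
    if "continuous_on (ball 0 1) Y" "s \<in> ?U" for Y :: "complex \<Rightarrow> complex" and s T
    by (rule continuous_on_compose2[OF that(1), of T "\<lambda>t. complex_of_real s * cis t"])
       (use that in \<open>auto simp: norm_mult intro!: continuous_intros\<close>)
  have int: "(\<lambda>t. a (of_real r * cis t) * cis t) integrable_on {0..2*pi}"
            "(\<lambda>t. b (of_real r * cis t) * cnj (cis t)) integrable_on {0..2*pi}"
    using r by (intro integrable_continuous_interval continuous_intros comp1 ca cb; simp)+
  have dr: "((\<lambda>s. X (of_real s * cis t)) has_vector_derivative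
          a (of_real s * cis t) * cis t + b (of_real s * cis t) * cnj (cis t)) (at s within V)"
    if s: "s \<in> ?U" for s t V
  proof -
    have g: "((\<lambda>s. complex_of_real s * cis t) has_derivative (\<lambda>h. of_real h * cis t)) (at s within V)"
      by (auto intro!: derivative_eq_intros)
    have "(X has_derivative (\<lambda>h. a (of_real s * cis t) * h + b (of_real s * cis t) * cnj h))
            (at (of_real s * cis t))"
      using X[OF rcis_in_disc, of s t] s unfolding has_wirtinger_def by simp
    from diff_chain_within[OF g has_derivative_at_withinI[OF this]]
    show ?thesis
      unfolding has_vector_derivative_def o_def
      by (rule has_derivative_eq_rhs) (auto simp: scaleR_conv_of_real algebra_simps)
  qed
  have dt: "((\<lambda>t. X (of_real r * cis t)) has_vector_derivative
          \<i> * of_real r * (a (of_real r * cis t) * cis t - b (of_real r * cis t) * cnj (cis t))) (at t within V)"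
    for t V
  proof -
    have g: "((\<lambda>t. complex_of_real r * cis t) has_derivative (\<lambda>h. of_real r * (of_real h * (\<i> * cis t)))) (at t within V)"
      by (rule has_derivative_eq_rhs, rule has_derivative_mult_right, rule has_derivative_cis)
         (auto intro!: derivative_eq_intros simp: scaleR_conv_of_real)
    have "(X has_derivative (\<lambda>h. a (of_real r * cis t) * h + b (of_real r * cis t) * cnj h))
            (at (of_real r * cis t))"
      using X[OF rcis_in_disc, of r t] r unfolding has_wirtinger_def by simp
    from diff_chain_within[OF g has_derivative_at_withinI[OF this]]
    show ?thesis
      unfolding has_vector_derivative_def o_def
      by (rule has_derivative_eq_rhs) (auto simp: scaleR_conv_of_real algebra_simps)
  qed
  have "((\<lambda>t. \<i> * of_real r * (a (of_real r * cis t) * cis t - b (of_real r * cis t) * cnj (cis t)))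
     has_integral (X (of_real r * cis (2*pi)) - X (of_real r * cis 0))) {0..2*pi}"
    by (rule fundamental_theorem_of_calculus) (auto intro: dt)
  then have "((\<lambda>t. (\<i> * of_real r) * (a (of_real r * cis t) * cis t - b (of_real r * cis t) * cnj (cis t)))
     has_integral 0) {0..2*pi}"
    by simp
  then have "integral {0..2*pi} (\<lambda>t. (\<i> * of_real r) * (a (of_real r * cis t) * cis t - b (of_real r * cis t) * cnj (cis t))) = 0"
    by (rule integral_unique)
  then have "(\<i> * of_real r) * (integral {0..2*pi} (\<lambda>t. a (of_real r * cis t) * cis t - b (of_real r * cis t) * cnj (cis t))) = 0"
    by (simp add: integral_mult_right)
  then have "integral {0..2*pi} (\<lambda>t. a (of_real r * cis t) * cis t - b (of_real r * cis t) * cnj (cis t)) = 0"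
    using r by simp
  then show eq: "integral {0..2*pi} (\<lambda>t. a (of_real r * cis t) * cis t)
       = integral {0..2*pi} (\<lambda>t. b (of_real r * cis t) * cnj (cis t))"
    by (simp add: integral_diff[OF int])
  have "((\<lambda>r. integral (cbox 0 (2*pi)) (\<lambda>t. X (of_real r * cis t))) has_vector_derivative
     integral (cbox 0 (2*pi)) (\<lambda>t. a (of_real r * cis t) * cis t + b (of_real r * cis t) * cnj (cis t)))
     (at r within ?U)"
  proof (rule leibniz_rule_vector_derivative)
    show "continuous_on (?U \<times> cbox 0 (2*pi)) (\<lambda>(s, t). a (complex_of_real s * cis t) * cis t +
         b (complex_of_real s * cis t) * cnj (cis t))"
      unfolding split_beta by (intro continuous_intros comp ca cb)
    show "(\<lambda>t. X (complex_of_real x * cis t)) integrable_on cbox 0 (2 * pi)" if "x \<in> ?U" for x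
      using comp1[OF cX that, of "{0..2*pi}"] integrable_continuous_interval by simp
  qed (use r dr in auto)
  moreover have "integral (cbox 0 (2*pi)) (\<lambda>t. a (of_real r * cis t) * cis t + b (of_real r * cis t) * cnj (cis t))
     = 2 * integral {0..2*pi} (\<lambda>t. a (of_real r * cis t) * cis t)"
    using integral_add[OF int] eq by simp
  moreover have "at r within ?U = at r"
    by (rule at_within_open) (use r in auto)
  ultimately show "((\<lambda>r. integral {0..2*pi} (\<lambda>t. X (of_real r * cis t))) has_vector_derivative
            2 * integral {0..2*pi} (\<lambda>t. a (of_real r * cis t) * cis t)) (at r)"
    by simp
qed

lemma has_real_derivative_Re:
  "(f has_vector_derivative d) (at x) \<Longrightarrow> ((\<lambda>x. Re (f x)) has_real_derivative Re d) (at x)"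
  unfolding has_field_derivative_def has_vector_derivative_def
  by (drule has_derivative_Re) (simp add: mult_commute_abs)

text \<open>\<open>4 c\<close> is the Laplacian of \<open>W\<close>. With \<open>u r\<close> the integral of \<open>W\<close> over the circle of radius \<open>r\<close> and \<open>N r\<close>
  that of \<open>cnj z b z\<close>, one has \<open>u' = (2 / r) N\<close> and \<open>N' = 2 r \<integral>c\<close>, so both increase.\<close>

lemma sub_mean_value:
  assumes W: "\<And>z. z \<in> ball 0 1 \<Longrightarrow> has_wirtinger W (a z) (b z) z"
    and B: "\<And>z. z \<in> ball 0 1 \<Longrightarrow> has_wirtinger b (c z) (d z) z"
    and ca: "continuous_on (ball 0 1) a" 
    and cc: "continuous_on (ball 0 1) c" and cd: "continuous_on (ball 0 1) d"
    and cW: "continuous_on (cball 0 1) W"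
    and pos: "\<And>z. z \<in> ball 0 1 \<Longrightarrow> Re (c z) \<ge> 0"
  shows "Re (W 0) \<le> Re (cmean W)"
proof -
  define u where "u r = integral {0..2*pi} (\<lambda>t. W (of_real r * cis t))" for r
  define N where "N r = integral {0..2*pi} (\<lambda>t. b (of_real r * cis t) * cnj (of_real r * cis t))" for r
  have cb: "continuous_on (ball 0 1) b"
    using B unfolding has_wirtinger_def
    by (meson continuous_at_imp_continuous_on has_derivative_continuous)
  \<comment> \<open>The factor \<open>cnj z\<close> makes \<open>N\<close> a circle integral of a
    single function. Its derivative in \<open>z\<close> is \<open>c z * cnj z\<close>, and
    multiplication by \<open>cis t\<close> leaves only the radius as a factor of
    \<open>c z\<close>.\<close>
  have Y: "has_wirtinger (\<lambda>z. b z * cnj z) (c z * cnj z) (d z * cnj z + b z) z" if "z \<in> ball 0 1" for z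
    by (rule has_wirtinger_eqI[OF has_wirtinger_mult[OF B[OF that] has_wirtinger_cnj[OF has_wirtinger_holo[OF DERIV_ident]]]]) auto
  have contN: "continuous_on {0..<1} N"
  proof -
    have "continuous_on ({0..<1} \<times> cbox 0 (2*pi)) (\<lambda>p. b (complex_of_real (fst p) * cis (snd p)))"
      by (rule continuous_on_compose2[OF cb]) (auto simp: norm_mult intro!: continuous_intros)
    then have "continuous_on ({0..<1} \<times> cbox 0 (2*pi))
       (\<lambda>(r,t). b (complex_of_real r * cis t) * cnj (of_real r * cis t))"
      unfolding split_beta by (intro continuous_intros)
    from integral_continuous_on_param[OF this] show ?thesis
      unfolding N_def by simp
  qed
  \<comment> \<open>The Wirtinger derivatives are available in the open disc only; continuity of
    \<open>W\<close> on the closed disc carries the comparison up to radius 1.\<close>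
  have contu: "continuous_on {0..1} u"
  proof -
    have "continuous_on ({0..1} \<times> cbox 0 (2*pi)) (\<lambda>p. W (complex_of_real (fst p) * cis (snd p)))"
      by (rule continuous_on_compose2[OF cW]) (auto simp: norm_mult intro!: continuous_intros)
    then have "continuous_on ({0..1} \<times> cbox 0 (2*pi)) (\<lambda>(r,t). W (complex_of_real r * cis t))"
      unfolding split_beta .
    from integral_continuous_on_param[OF this] show ?thesis
      unfolding u_def by simp
  qed
  have Npos: "Re (N r) \<ge> 0" if r: "0 < r" "r < 1" for r
  proof -
    have "Re (N 0) \<le> Re (N r)"
    proof (rule DERIV_nonneg_imp_increasing_open[where f = "\<lambda>x. Re (N x)"])
      fix s :: real assume s: "0 < s" "s < r"
      let ?e = "2 * integral {0..2*pi} (\<lambda>t. c (of_real s * cis t) * cnj (of_real s * cis t) * cis t)"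
      have "(N has_vector_derivative ?e) (at s)"
        unfolding N_def
        by (rule circle_integral_derivative(1)[OF Y]) (use s r in \<open>auto intro!: continuous_intros cc cd cb\<close>)
      then have "((\<lambda>x. Re (N x)) has_real_derivative Re ?e) (at s)"
        by (rule has_real_derivative_Re)
      moreover have "?e = 2 * integral {0..2*pi} (\<lambda>t. of_real s * c (of_real s * cis t))"
      proof -
        have *: "w * cnj (of_real s * cis t) * cis t = of_real s * w" for w t
          using cis_mult[of t "- t"] by (simp add: cis_cnj mult.assoc mult.left_commute mult.commute)
        show ?thesis by (simp only: *)
      qed
      moreover have "Re (integral {0..2*pi} (\<lambda>t. of_real s * c (of_real s * cis t))) \<ge> 0"
      proof -
        have cs: "continuous_on {0..2*pi} (\<lambda>t. of_real s * c (of_real s * cis t))"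
          by (intro continuous_intros continuous_on_compose2[OF cc, of _ "\<lambda>t. of_real s * cis t"])
             (use s r in \<open>auto simp: norm_mult\<close>)
        then have "Re (integral {0..2*pi} (\<lambda>t. of_real s * c (of_real s * cis t)))
            = integral {0..2*pi} (\<lambda>t. Re (of_real s * c (of_real s * cis t)))"
          by (rule integral_linear[OF integrable_continuous_interval bounded_linear_Re, unfolded o_def, symmetric])
        also have "\<dots> \<ge> 0"
          by (rule integral_nonneg[OF integrable_continuous_interval[OF continuous_on_Re[OF cs]]])
             (use s r rcis_in_disc pos in auto)
        finally show ?thesis .
      qed
      ultimately have "((\<lambda>x. Re (N x)) has_real_derivative Re ?e) (at s)" "Re ?e \<ge> 0"
        by auto
      then show "\<exists>y. ((\<lambda>x. Re (N x)) has_real_derivative y) (at s) \<and> y \<ge> 0"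
        by blast
    next
      show "continuous_on {0..r} (\<lambda>x. Re (N x))"
        by (intro continuous_intros continuous_on_subset[OF contN]) (use r in auto)
    qed (use r in auto)
    then show ?thesis by (simp add: N_def)
  qed
  have "Re (u 0) \<le> Re (u 1)"
  proof (rule DERIV_nonneg_imp_increasing_open[where f = "\<lambda>x. Re (u x)"])
    fix s :: real assume s: "0 < s" "s < 1"
    let ?e = "2 * integral {0..2*pi} (\<lambda>t. a (of_real s * cis t) * cis t)"
    have "(u has_vector_derivative ?e) (at s)"
      unfolding u_def by (rule circle_integral_derivative(1)[OF W]) (use s ca cb in auto)
    then have "((\<lambda>x. Re (u x)) has_real_derivative Re ?e) (at s)"
      by (rule has_real_derivative_Re)
    moreover have "of_real s * integral {0..2*pi} (\<lambda>t. a (of_real s * cis t) * cis t) = N s"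
      unfolding N_def
      by (subst circle_integral_derivative(2)[OF W ca cb s])
         (auto simp: mult_ac simp flip: integral_mult_right)
    then have "s * Re (integral {0..2*pi} (\<lambda>t. a (of_real s * cis t) * cis t)) = Re (N s)"
      by (metis Re_complex_of_real scaleR_complex.simps(1) scaleR_conv_of_real)
    then have "Re ?e = 2 / s * Re (N s)"
      using s by (simp add: field_simps)
    ultimately show "\<exists>y. ((\<lambda>x. Re (u x)) has_real_derivative y) (at s) \<and> y \<ge> 0"
      using Npos[OF s] s by (intro exI[of _ "Re ?e"]) auto
  qed (auto intro!: continuous_intros contu)
  moreover have "u 0 = (2 * pi) *\<^sub>R W 0"
    by (simp add: u_def)
  moreover have "cmean W = u 1 / of_real (2 * pi)"
    by (simp add: u_def cmean_def)
  then have "Re (cmean W) = Re (u 1) / (2 * pi)"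
    by (simp only: Re_divide_of_real)
  ultimately show ?thesis
    by (simp add: pos_le_divide_eq mult.commute)
qed

section \<open>Square-summable power series\<close>

text \<open>Coefficient sequences are kept as formal power series, so that multiplication of
  functions is the Cauchy product and the shift is multiplication by \<open>fps_X\<close>.\<close>

definition l2 :: "complex fps \<Rightarrow> bool" where
  "l2 F \<longleftrightarrow> summable (\<lambda>n. (cmod (F $ n))\<^sup>2)"

definition l2_sq :: "complex fps \<Rightarrow> real" where
  "l2_sq F = (\<Sum>n. (cmod (F $ n))\<^sup>2)"

definition l2_inner :: "complex fps \<Rightarrow> complex fps \<Rightarrow> complex" where
  "l2_inner F G = (\<Sum>n. F $ n * cnj (G $ n))"

lemma l2_sq_nonneg: "l2 F \<Longrightarrow> l2_sq F \<ge> 0"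
  unfolding l2_sq_def l2_def by (rule suminf_nonneg) auto

lemma l2_summable_norm:
  assumes "l2 F" "l2 G"
  shows "summable (\<lambda>n. norm (F $ n * cnj (G $ n)))"
proof (rule summable_comparison_test'[where N = 0])
  show "summable (\<lambda>n. (cmod (F $ n))\<^sup>2 + (cmod (G $ n))\<^sup>2)"
    using assms by (auto simp: l2_def intro: summable_add)
  have "x * y \<le> x\<^sup>2 + y\<^sup>2" if "x \<ge> 0" "y \<ge> 0" for x y :: real
    using that sum_squares_bound[of x y] mult_nonneg_nonneg[OF that] by linarith
  then show "norm (norm (F $ n * cnj (G $ n))) \<le> (cmod (F $ n))\<^sup>2 + (cmod (G $ n))\<^sup>2" for n
    by (simp add: norm_mult)
qed

lemma l2_summable: "l2 F \<Longrightarrow> l2 G \<Longrightarrow> summable (\<lambda>n. F $ n * cnj (G $ n))"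
  by (rule summable_norm_cancel) (rule l2_summable_norm)

lemma of_real_cmod_squared: "complex_of_real ((cmod z)\<^sup>2) = z * cnj z"
  by (rule complex_norm_square)

lemma cmod_add_sq_le: "(cmod (x + y))\<^sup>2 \<le> 2 * (cmod x)\<^sup>2 + 2 * (cmod y)\<^sup>2"
proof -
  have "(cmod (x + y))\<^sup>2 \<le> (cmod x + cmod y)\<^sup>2"
    by (intro power_mono norm_triangle_ineq) auto
  also have "\<dots> \<le> 2 * (cmod x)\<^sup>2 + 2 * (cmod y)\<^sup>2"
    using sum_squares_bound[of "cmod x" "cmod y"] unfolding power2_sum by linarith
  finally show ?thesis .
qed

lemma l2_add: assumes "l2 F" "l2 G" shows "l2 (F + G)"
  unfolding l2_def
proof (rule summable_comparison_test'[where N = 0])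
  show "summable (\<lambda>n. 2 * (cmod (F $ n))\<^sup>2 + 2 * (cmod (G $ n))\<^sup>2)"
    using assms unfolding l2_def by (intro summable_add summable_mult)
  show "norm ((cmod ((F + G) $ n))\<^sup>2) \<le> 2 * (cmod (F $ n))\<^sup>2 + 2 * (cmod (G $ n))\<^sup>2" for n
    using cmod_add_sq_le[of "F $ n" "G $ n"] by simp
qed

lemma l2_cmult: "l2 F \<Longrightarrow> l2 (fps_const c * F)"
  unfolding l2_def by (auto simp: norm_mult power_mult_distrib intro!: summable_mult)

lemma l2_uminus: "l2 F \<Longrightarrow> l2 (- F)"
  unfolding l2_def by simp

lemma l2_diff: "l2 F \<Longrightarrow> l2 G \<Longrightarrow> l2 (F - G)"
  using l2_add[of F "- G"] l2_uminus[of G] by simp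

lemma l2_inner_add_left: "l2 F \<Longrightarrow> l2 G \<Longrightarrow> l2 H \<Longrightarrow> l2_inner (F + G) H = l2_inner F H + l2_inner G H"
  unfolding l2_inner_def by (simp add: algebra_simps suminf_add l2_summable)

lemma l2_inner_cmult_left: "l2 F \<Longrightarrow> l2 H \<Longrightarrow> l2_inner (fps_const c * F) H = c * l2_inner F H"
  unfolding l2_inner_def by (simp add: mult.assoc suminf_mult l2_summable)

lemma l2_inner_cnj: "l2 F \<Longrightarrow> l2 G \<Longrightarrow> l2_inner G F = cnj (l2_inner F G)"
  unfolding l2_inner_def 
  using bounded_linear.suminf[OF bounded_linear_cnj l2_summable, of F G] by (simp add: mult.commute)

lemma l2_inner_uminus_left: "l2 F \<Longrightarrow> l2 H \<Longrightarrow> l2_inner (- F) H = - l2_inner F H"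
  using l2_inner_cmult_left[of F H "-1"] by (simp flip: fps_const_neg)

lemma l2_inner_diff_left: "l2 F \<Longrightarrow> l2 G \<Longrightarrow> l2 H \<Longrightarrow> l2_inner (F - G) H = l2_inner F H - l2_inner G H"
  using l2_inner_add_left[of F "- G" H] by (simp add: l2_inner_uminus_left l2_uminus)

lemma l2_inner_add_right: "l2 F \<Longrightarrow> l2 G \<Longrightarrow> l2 H \<Longrightarrow> l2_inner H (F + G) = l2_inner H F + l2_inner H G"
  using l2_inner_cnj[of "F + G" H] l2_inner_add_left[of F G H] l2_inner_cnj[of F H] l2_inner_cnj[of G H] by (simp add: l2_add)

lemma l2_inner_cmult_right: "l2 F \<Longrightarrow> l2 H \<Longrightarrow> l2_inner H (fps_const c * F) = cnj c * l2_inner H F"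
  using l2_inner_cnj[of "fps_const c * F" H] l2_inner_cmult_left[of F H c] l2_inner_cnj[of F H] by (simp add: l2_cmult)

lemma l2_inner_self: "l2 F \<Longrightarrow> l2_inner F F = of_real (l2_sq F)"
  unfolding l2_inner_def l2_sq_def l2_def
  by (simp add: suminf_of_real flip: complex_norm_square of_real_power)

lemma l2_sq_add: assumes "l2 F" "l2 G" shows "l2_sq (F + G) = l2_sq F + l2_sq G + 2 * Re (l2_inner F G)"
proof -
  have "complex_of_real (l2_sq (F + G)) = l2_inner F F + l2_inner G G + (l2_inner F G + l2_inner G F)"
    using assms by (simp add: l2_inner_add_left l2_inner_add_right l2_add flip: l2_inner_self)
  also have "l2_inner F G + l2_inner G F = of_real (2 * Re (l2_inner F G))"
    by (subst l2_inner_cnj[OF assms]) (rule complex_add_cnj)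
  finally show ?thesis
    by (simp only: l2_inner_self[OF assms(1)] l2_inner_self[OF assms(2)] of_real_eq_iff flip: of_real_add)
qed

lemma l2_sq_cmult: "l2 F \<Longrightarrow> l2_sq (fps_const c * F) = (cmod c)\<^sup>2 * l2_sq F"
  unfolding l2_sq_def l2_def by (simp add: norm_mult power_mult_distrib suminf_mult)

lemma l2_sq_uminus: "l2_sq (- F) = l2_sq F"
  unfolding l2_sq_def by simp

lemma l2_sq_diff: "l2 F \<Longrightarrow> l2 G \<Longrightarrow> l2_sq (F - G) = l2_sq F + l2_sq G - 2 * Re (l2_inner F G)"
  using l2_sq_add[of F "- G"] l2_inner_cmult_right[of G F "-1"]
  by (simp add: l2_uminus l2_sq_uminus flip: fps_const_neg)

lemma l2_poly: "l2 (fps_of_poly p)"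
  unfolding l2_def by (rule summable_finite[of "{..degree p}"]) (auto simp: coeff_eq_0)

lemma l2_shift: "l2 F \<Longrightarrow> l2 (F * fps_X ^ m)"
  unfolding l2_def fps_X_power_mult_right_nth
  by (subst summable_iff_shift[of _ m, symmetric]) simp

section \<open>Truncations, their tails and their limits\<close>

definition trunc :: "nat \<Rightarrow> complex fps \<Rightarrow> complex fps" where
  "trunc N F = Abs_fps (\<lambda>n. if n < N then F $ n else 0)"

lemma trunc_nth [simp]: "trunc N F $ n = (if n < N then F $ n else 0)"
  by (simp add: trunc_def)

lemma l2_trunc: "l2 (trunc N F)"
  unfolding l2_def by (rule summable_finite[of "{..<N}"]) auto

lemma l2_sq_trunc: "l2_sq (trunc N F) = (\<Sum>n<N. (cmod (F $ n))\<^sup>2)"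
  unfolding l2_sq_def by (subst suminf_finite[of "{..<N}"]) auto

lemma l2_inner_trunc_left: "l2_inner (trunc N F) G = (\<Sum>n<N. F $ n * cnj (G $ n))"
  unfolding l2_inner_def by (subst suminf_finite[of "{..<N}"]) auto

lemma l2_sq_trunc_le: "l2 F \<Longrightarrow> l2_sq (trunc N F) \<le> l2_sq F"
  unfolding l2_sq_trunc unfolding l2_sq_def l2_def by (rule sum_le_suminf) auto

lemma l2_sq_trunc_lim: "l2 F \<Longrightarrow> (\<lambda>N. l2_sq (trunc N F)) \<longlonglongrightarrow> l2_sq F"
  unfolding l2_sq_trunc unfolding l2_sq_def l2_def by (rule summable_LIMSEQ)

text \<open>Truncation and tail have disjoint supports, hence are orthogonal.\<close>

lemma l2_sq_tail: "l2 F \<Longrightarrow> l2_sq (F - trunc N F) = l2_sq F - l2_sq (trunc N F)"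
proof -
  assume F: "l2 F"
  have "l2_sq (trunc N F + (F - trunc N F)) = l2_sq (trunc N F) + l2_sq (F - trunc N F)"
    by (subst l2_sq_add) (auto simp: l2_trunc F l2_diff l2_inner_trunc_left)
  then show ?thesis by simp
qed

lemma l2_sq_tail_lim: "l2 F \<Longrightarrow> (\<lambda>N. l2_sq (F - trunc N F)) \<longlonglongrightarrow> 0"
  using tendsto_diff[OF tendsto_const[of "l2_sq F"] l2_sq_trunc_lim[of F]] by (simp add: l2_sq_tail)

lemma trunc_poly: "\<exists>p. trunc N F = fps_of_poly p"
proof (intro exI fps_ext)
  fix n show "trunc N F $ n = fps_of_poly (\<Sum>i<N. monom (F $ i) i) $ n"
    by (simp add: coeff_sum)
qed

text \<open>Bounds on truncations survive coefficientwise limits; this converts them back into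
  square-summability and a norm bound.\<close>

lemma l2_of_bounded:
  assumes "\<And>N. l2_sq (trunc N F) \<le> C" shows "l2 F \<and> l2_sq F \<le> C"
proof -
  have "l2 F" unfolding l2_def
    by (rule bounded_imp_summable[of _ C]) 
       (use assms[of "Suc _"] in \<open>auto simp: l2_sq_trunc lessThan_Suc_atMost\<close>)
  then show ?thesis using l2_sq_trunc_lim[of F] assms LIMSEQ_le_const2 by blast
qed

section \<open>Circle means of polynomials\<close>

lemma cmean_cis_int:
  "integral {0..2*pi} (\<lambda>t. cis (of_int k * t)) = (if k = 0 then 2 * pi else 0)"
proof (cases "k = 0")
  case False
  have "((\<lambda>t. cis (of_int k * t)) has_integral
     (cis (of_int k * (2*pi)) / (\<i> * of_int k) - cis (of_int k * 0) / (\<i> * of_int k))) {0..2*pi}"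
  proof (rule fundamental_theorem_of_calculus)
    have *: "\<i> * (u * (\<i> * v)) = - (u * v)" for u v
      using mult.assoc[of \<i> \<i> "u * v"] by (simp add: mult.left_commute)
    fix t :: real
    have "((\<lambda>t. cis (of_int k * t) / (\<i> * of_int k)) has_derivative
             (\<lambda>h. ((of_int k * h) *\<^sub>R (\<i> * cis (of_int k * t))) / (\<i> * of_int k))) (at t within {0..2*pi})"
      by (intro has_derivative_divide' has_derivative_cis derivative_eq_intros) (use False in auto)
    then show "((\<lambda>t. cis (of_int k * t) / (\<i> * of_int k)) has_vector_derivative cis (of_int k * t)) (at t within {0..2*pi})"
      unfolding has_vector_derivative_def
      by (rule has_derivative_eq_rhs) (use False in \<open>simp add: scaleR_conv_of_real fun_eq_iff *\<close>)
  qed auto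
  moreover have "cis (of_int k * (2*pi)) = 1"
    using cis_multiple_2pi[of "of_int k"] by (simp add: mult_ac)
  ultimately show ?thesis using False by (simp add: integral_unique)
qed (simp add: scaleR_conv_of_real)

definition circle_cont :: "(complex \<Rightarrow> complex) \<Rightarrow> bool" where
  "circle_cont F \<longleftrightarrow> continuous_on (sphere 0 1) F"

lemma circle_cont_integrable: "circle_cont F \<Longrightarrow> (\<lambda>t. F (cis t)) integrable_on {0..2*pi}"
  unfolding circle_cont_def
  by (intro integrable_continuous_interval continuous_on_compose2[of "sphere 0 1" F _ cis])
     (auto intro!: continuous_intros)

lemma cmean_add: "circle_cont F \<Longrightarrow> circle_cont G \<Longrightarrow> cmean (\<lambda>z. F z + G z) = cmean F + cmean G"
  by (simp add: cmean_def integral_add circle_cont_integrable add_divide_distrib)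

lemma cmean_diff: "circle_cont F \<Longrightarrow> circle_cont G \<Longrightarrow> cmean (\<lambda>z. F z - G z) = cmean F - cmean G"
  by (simp add: cmean_def integral_diff circle_cont_integrable diff_divide_distrib)

lemma cmean_cmult: "cmean (\<lambda>z. c * F z) = c * cmean F"
  by (simp add: cmean_def)

lemma cmean_sum: "(\<And>i. i \<in> A \<Longrightarrow> circle_cont (F i)) \<Longrightarrow> finite A \<Longrightarrow> cmean (\<lambda>z. \<Sum>i\<in>A. F i z) = (\<Sum>i\<in>A. cmean (F i))"
  by (simp add: cmean_def integral_sum circle_cont_integrable sum_divide_distrib)

lemma cmean_cong: "(\<And>z. cmod z = 1 \<Longrightarrow> F z = G z) \<Longrightarrow> cmean F = cmean G"
  by (simp add: cmean_def)

text \<open>The majorant \<open>G\<close> is complex-valued, with its real part in the bound, so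
  that its mean can be expanded by the linearity of \<open>cmean\<close>.\<close>

lemma cmean_norm_le:
  assumes "circle_cont F" "circle_cont G" "\<And>z. cmod z = 1 \<Longrightarrow> cmod (F z) \<le> Re (G z)"
  shows "cmod (cmean F) \<le> Re (cmean G)"
proof -
  have "((\<lambda>t. Re (G (cis t))) has_integral Re (integral {0..2*pi} (\<lambda>t. G (cis t)))) {0..2*pi}"
    using has_integral_linear[OF integrable_integral[OF circle_cont_integrable[OF assms(2)]] bounded_linear_Re]
    by (simp add: o_def)
  note int = this
  from integral_norm_bound_integral[OF circle_cont_integrable[OF assms(1)] has_integral_integrable[OF int]]
  have "norm (integral {0..2*pi} (\<lambda>t. F (cis t))) \<le> Re (integral {0..2*pi} (\<lambda>t. G (cis t)))"
    unfolding integral_unique[OF int] using assms(3) by auto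
  moreover have "cmod (cmean F) = norm (integral {0..2*pi} (\<lambda>t. F (cis t))) / (2 * pi)"
    by (simp add: cmean_def norm_divide)
  moreover have "cmean G = integral {0..2*pi} (\<lambda>t. G (cis t)) / of_real (2 * pi)"
    by (simp add: cmean_def)
  then have "Re (cmean G) = Re (integral {0..2*pi} (\<lambda>t. G (cis t))) / (2 * pi)"
    by (simp only: Re_divide_of_real)
  ultimately show ?thesis
    by (simp add: divide_right_mono)
qed

lemma cmean_monom: "cmean (\<lambda>z. z ^ i * cnj z ^ j) = (if i = j then 1 else 0)"
proof -
  have "cis t ^ i * cnj (cis t) ^ j = cis (of_int (int i - int j) * t)" for t
    by (simp add: cis_cnj Complex.DeMoivre cis_mult algebra_simps)
  then show ?thesis
    unfolding cmean_def using cmean_cis_int[of "int i - int j"] by simp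
qed

lemma circle_cont_poly [simp, intro]: "circle_cont (\<lambda>z. poly p z)" "circle_cont (\<lambda>z. cnj (poly p z))"
  by (auto simp: circle_cont_def intro!: continuous_intros)

lemma circle_cont_mult [simp, intro]: "circle_cont F \<Longrightarrow> circle_cont G \<Longrightarrow> circle_cont (\<lambda>z. F z * G z)"
  by (auto simp: circle_cont_def intro!: continuous_intros)

lemma circle_cont_add [simp, intro]: "circle_cont F \<Longrightarrow> circle_cont G \<Longrightarrow> circle_cont (\<lambda>z. F z + G z)"
  by (auto simp: circle_cont_def intro!: continuous_intros)

lemma circle_cont_const: "circle_cont (\<lambda>z. c)"
  by (simp add: circle_cont_def)

lemma cmean_sum_list:
  "(\<And>g. g \<in> set gs \<Longrightarrow> circle_cont (F g)) \<Longrightarrow>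
     circle_cont (\<lambda>z. \<Sum>g\<leftarrow>gs. F g z) \<and> cmean (\<lambda>z. \<Sum>g\<leftarrow>gs. F g z) = (\<Sum>g\<leftarrow>gs. cmean (F g))"
proof (induction gs)
  case Nil
  then show ?case by (simp add: cmean_def circle_cont_def)
next
  case (Cons g gs)
  then show ?case by (simp add: cmean_add circle_cont_add)
qed

text \<open>Both polynomials are expanded, and the monomials are orthonormal on the circle by
  \<open>cmean_monom\<close>.\<close>

lemma parseval_poly:
  "cmean (\<lambda>z. poly p z * cnj (poly q z)) = l2_inner (fps_of_poly p) (fps_of_poly q)"
proof -
  have "poly p z * cnj (poly q z) =
     (\<Sum>i\<le>degree p. \<Sum>j\<le>degree q. (coeff p i * cnj (coeff q j)) * (z ^ i * cnj z ^ j))" for z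
    by (simp add: poly_altdef sum_product mult_ac)
  then have "cmean (\<lambda>z. poly p z * cnj (poly q z)) =
     (\<Sum>i\<le>degree p. \<Sum>j\<le>degree q. (coeff p i * cnj (coeff q j)) * cmean (\<lambda>z. z ^ i * cnj z ^ j))"
    by (simp add: cmean_sum cmean_cmult circle_cont_def continuous_intros)
  also have "\<dots> = (\<Sum>i\<le>degree p. coeff p i * cnj (coeff q i))"
    unfolding cmean_monom
    by (intro sum.cong refl) (auto simp: if_distrib[of "(*) _"] sum.delta coeff_eq_0 cong: if_cong)
  also have "\<dots> = l2_inner (fps_of_poly p) (fps_of_poly q)"
    unfolding l2_inner_def by (subst suminf_finite[of "{..degree p}"]) (auto simp: coeff_eq_0)
  finally show ?thesis .
qed

lemma l2_sq_poly: "cmean (\<lambda>z. of_real ((cmod (poly p z))\<^sup>2)) = of_real (l2_sq (fps_of_poly p))"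
  using parseval_poly[of p p] by (simp add: l2_inner_self l2_poly flip: complex_norm_square of_real_power)

lemma l2_sq_poly_mult_le:
  assumes "\<And>z. cmod z = 1 \<Longrightarrow> cmod (poly P z) \<le> M"
  shows "l2_sq (fps_of_poly (P * g)) \<le> M\<^sup>2 * l2_sq (fps_of_poly g)"
proof -
  have "cmod (cmean (\<lambda>z. of_real ((cmod (poly (P * g) z))\<^sup>2))) \<le> Re (cmean (\<lambda>z. of_real (M\<^sup>2) * of_real ((cmod (poly g z))\<^sup>2)))"
    by (rule cmean_norm_le)
       (use assms in \<open>auto simp: circle_cont_def norm_mult power_mult_distrib intro!: continuous_intros mult_right_mono power_mono simp flip: of_real_mult of_real_power\<close>)
  then show ?thesis unfolding cmean_cmult l2_sq_poly by (simp add: l2_sq_nonneg l2_poly)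
qed

section \<open>The corona estimate for polynomials\<close>

text \<open>By \<open>circle_split_coeff\<close> below, \<open>p\<close> is the image of \<open>k\<close> under the adjoint of multiplication by \<open>P\<close>.\<close>

lemma circle_split:
  fixes P k :: "complex poly"
  shows "\<exists>p R. poly R 0 = 0 \<and>
    (\<forall>z. cmod z = 1 \<longrightarrow> poly P z * cnj (poly k z) = cnj (poly p z) + poly R z)"
proof (induction k)
  case 0
  show ?case by (intro exI[of _ 0]) auto
next
  case (pCons c k)
  then obtain p R where R: "poly R 0 = 0"
    and eq: "\<And>z. cmod z = 1 \<Longrightarrow> poly P z * cnj (poly k z) = cnj (poly p z) + poly R z" by blast
  \<comment> \<open>Multiplication by \<open>cnj z\<close> lowers every frequency by one. The
    coefficient \<open>r\<close> of \<open>z\<close> in \<open>R\<close> becomes constant and joins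
    the conjugate part together with the multiple of \<open>P0\<close>, which keeps the new
    remainder zero at the origin.\<close>
  obtain R' where R': "R = pCons 0 R'" using R by (cases R) auto
  obtain r R'' where R'': "R' = pCons r R''" by (cases R') auto
  obtain P0 P' where P: "P = pCons P0 P'" by (cases P) auto
  show ?case
  proof (intro exI conjI allI impI)
    show "poly (pCons 0 (smult (cnj c) P' + R'')) 0 = 0" by simp
    fix z assume z: "cmod z = 1"
    then have zz: "z * cnj z = 1" by (simp flip: complex_norm_square)
    have "poly P z * cnj (poly (pCons c k) z) = cnj c * poly P z + cnj z * (poly P z * cnj (poly k z))"
      by (simp add: algebra_simps)
    also have "\<dots> = cnj c * (P0 + z * poly P' z) + cnj z * cnj (poly p z) + (z * cnj z) * (r + z * poly R'' z)"
      unfolding eq[OF z] by (simp add: R' R'' P algebra_simps)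
    also have "\<dots> = cnj (poly (pCons (cnj (cnj c * P0 + r)) p) z) + poly (pCons 0 (smult (cnj c) P' + R'')) z"
      unfolding zz by (simp add: algebra_simps)
    finally show "poly P z * cnj (poly (pCons c k) z) =
        cnj (poly (pCons (cnj (cnj c * P0 + r)) p) z) + poly (pCons 0 (smult (cnj c) P' + R'')) z" .
  qed
qed

lemma l2_inner_X_power: "l2 F \<Longrightarrow> l2_inner F (fps_X ^ n) = F $ n"
  unfolding l2_inner_def by (subst suminf_finite[of "{n}"]) (auto simp: fps_X_power_nth)

text \<open>Conjugating the split and pairing with \<open>z ^ n\<close> leaves, besides the
  coefficient of \<open>p\<close>, the conjugate mean of \<open>R\<close> times
  \<open>z ^ n\<close>, which is zero because \<open>R\<close> vanishes at the origin. In particular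
  the split determines \<open>p\<close>.\<close>

lemma circle_split_coeff:
  assumes "poly R 0 = 0"
    and eq: "\<And>z. cmod z = 1 \<Longrightarrow> poly P z * cnj (poly k z) = cnj (poly p z) + poly R z"
  shows "coeff p n = l2_inner (fps_of_poly k) (fps_of_poly P * fps_X ^ n)"
proof -
  have X: "fps_X ^ n = fps_of_poly (monom (1::complex) n)"
    by (simp add: fps_of_poly_monom')
  have "l2_inner (fps_of_poly k) (fps_of_poly P * fps_X ^ n) = cmean (\<lambda>z. poly k z * cnj (poly (P * monom 1 n) z))"
    unfolding X parseval_poly fps_of_poly_mult ..
  also have "\<dots> = cmean (\<lambda>z. poly p z * cnj (poly (monom 1 n) z) + poly 1 z * cnj (poly (R * monom 1 n) z))"
  proof (rule cmean_cong)
    fix z :: complex assume "cmod z = 1"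
    from arg_cong[OF eq[OF this], of cnj]
    have "cnj (poly P z) * poly k z = poly p z + cnj (poly R z)" by simp
    then have "(cnj (poly P z) * poly k z) * cnj z ^ n = (poly p z + cnj (poly R z)) * cnj z ^ n" by simp
    then show "poly k z * cnj (poly (P * monom 1 n) z) =
         poly p z * cnj (poly (monom 1 n) z) + poly 1 z * cnj (poly (R * monom 1 n) z)"
      by (simp add: poly_monom algebra_simps)
  qed
  also have "\<dots> = l2_inner (fps_of_poly p) (fps_X ^ n) + l2_inner (fps_of_poly 1) (fps_of_poly (R * monom 1 n))"
    by (subst cmean_add) (auto simp only: X parseval_poly intro!: circle_cont_mult circle_cont_poly)
  also have "l2_inner (fps_of_poly 1) (fps_of_poly (R * monom 1 n)) = cnj (fps_of_poly (R * monom 1 n) $ 0)"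
    using l2_inner_X_power[OF l2_poly, of "R * monom 1 n" 0] l2_inner_cnj[OF l2_poly l2_poly, of "R * monom 1 n" 1] by simp
  also have "\<dots> = 0"
    using assms(1) by (simp add: fps_of_poly_mult poly_0_coeff_0)
  finally show ?thesis by (simp add: l2_inner_X_power l2_poly)
qed

section \<open>Laplacian estimates for the corona problem\<close>

lemma has_wirtinger_poly: "has_wirtinger (poly p) (poly (pderiv p) z) 0 z"
  by (rule has_wirtinger_holo) (rule poly_DERIV)

lemma has_wirtinger_cnj_poly: "has_wirtinger (\<lambda>z. cnj (poly p z)) 0 (cnj (poly (pderiv p) z)) z"
  using has_wirtinger_cnj[OF has_wirtinger_poly] by simp

lemma has_wirtinger_sum_list:
  "(\<And>g. g \<in> set gs \<Longrightarrow> has_wirtinger (X g) (a g) (b g) z) \<Longrightarrow>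
     has_wirtinger (\<lambda>z. \<Sum>g\<leftarrow>gs. X g z) (\<Sum>g\<leftarrow>gs. a g) (\<Sum>g\<leftarrow>gs. b g) z"
  by (induction gs) (auto intro!: has_wirtinger_const has_wirtinger_add)

text \<open>Lagrange's identity: the squares of the two sides differ by the square of
  \<open>a * d - b * c\<close>.\<close>

lemma cauchy_schwarz_real2: "a * c + b * d \<le> sqrt (a\<^sup>2 + b\<^sup>2) * sqrt (c\<^sup>2 + d\<^sup>2)" for a b c d :: real
proof -
  have "(a * c + b * d)\<^sup>2 \<le> (a\<^sup>2 + b\<^sup>2) * (c\<^sup>2 + d\<^sup>2)"
    using sum_squares_ge_zero[of "a * d - b * c" 0] by (simp add: power2_eq_square algebra_simps)
  then have "\<bar>a * c + b * d\<bar> \<le> sqrt ((a\<^sup>2 + b\<^sup>2) * (c\<^sup>2 + d\<^sup>2))"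
    by (metis real_sqrt_abs real_sqrt_le_mono)
  then show ?thesis by (simp add: real_sqrt_mult)
qed

text \<open>The first factor comes from the powers of \<open>S\<close> in the denominators of the
  Laplacian of \<open>G\<close>, the second from trading derivatives of the multipliers for
  derivatives of products.\<close>

definition corona_K :: "real \<Rightarrow> real \<Rightarrow> real" where
  "corona_K \<eta> M = (1 / (2 * \<eta> ^ 3) + 1 / \<eta> ^ 4) * (2 + 4 * M\<^sup>2)"

text \<open>The left-hand side is a quarter of the modulus of the Laplacian of \<open>G\<close>, the six squares on the right are a
  quarter of the Laplacians of \<open>\<bar>g\<bar>\<^sup>2\<close> for \<open>g\<close> among \<open>h, p\<^sub>1 h, p\<^sub>2 h, R, p\<^sub>1 R, p\<^sub>2 R\<close>.\<close>

lemma corona_pointwise: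
  fixes h h' R R' p1 p2 p1' p2' s D S :: complex
  assumes S: "S = p1 * cnj p1 + p2 * cnj p2"
    and s: "s = p1' * cnj p1 + p2' * cnj p2"
    and D: "D = p1' * p2 - p1 * p2'"
    and eta: "\<eta> > 0" "\<eta>\<^sup>2 \<le> (cmod p1)\<^sup>2 + (cmod p2)\<^sup>2"
    and M: "cmod p1 \<le> M" "cmod p2 \<le> M"
  shows "cmod ((h' * R + h * R') * cnj D / S\<^sup>2 - 2 * h * R * cnj D * s / S ^ 3)
    \<le> corona_K \<eta> M * ((cmod h')\<^sup>2 + (cmod (p1' * h + p1 * h'))\<^sup>2 + (cmod (p2' * h + p2 * h'))\<^sup>2
        + (cmod R')\<^sup>2 + (cmod (p1' * R + p1 * R'))\<^sup>2 + (cmod (p2' * R + p2 * R'))\<^sup>2)"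
proof -
  \<comment> \<open>\<open>p\<close> and \<open>q\<close> are the lengths of the vector of
    multipliers and of its derivative. \<open>S\<close> is the square of \<open>p\<close>, and
    Cauchy-Schwarz bounds both \<open>D\<close> and \<open>s\<close> by
    \<open>p * q\<close>.\<close>
  define p where "p = sqrt ((cmod p1)\<^sup>2 + (cmod p2)\<^sup>2)"
  define q where "q = sqrt ((cmod p1')\<^sup>2 + (cmod p2')\<^sup>2)"
  have p2: "p\<^sup>2 = (cmod p1)\<^sup>2 + (cmod p2)\<^sup>2" and q2: "q\<^sup>2 = (cmod p1')\<^sup>2 + (cmod p2')\<^sup>2"
    by (auto simp: p_def q_def)
  have p: "p \<ge> \<eta>" unfolding p_def using eta real_le_rsqrt by blast
  have q: "q \<ge> 0" by (simp add: q_def)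
  have S': "S = of_real (p\<^sup>2)" by (simp only: S p2 of_real_add of_real_cmod_squared)
  have D': "cmod D \<le> p * q"
  proof -
    have "cmod D \<le> cmod p1' * cmod p2 + cmod p1 * cmod p2'"
      unfolding D by (rule order_trans[OF norm_triangle_ineq4]) (simp add: norm_mult)
    also have "\<dots> \<le> p * q"
      using cauchy_schwarz_real2[of "cmod p1" "cmod p2'" "cmod p2" "cmod p1'"] by (simp add: p_def q_def algebra_simps)
    finally show ?thesis .
  qed
  have s': "cmod s \<le> p * q"
  proof -
    have "cmod s \<le> cmod p1' * cmod p1 + cmod p2' * cmod p2"
      unfolding s by (rule order_trans[OF norm_triangle_ineq]) (simp add: norm_mult)
    also have "\<dots> \<le> p * q"
      using cauchy_schwarz_real2[of "cmod p1" "cmod p1'" "cmod p2" "cmod p2'"] by (simp add: p_def q_def algebra_simps)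
    finally show ?thesis .
  qed
  have p0: "p > 0" using p eta by linarith
  \<comment> \<open>Both terms of the Laplacian are reduced to this one sum of squares by the
    inequality between arithmetic and geometric means.\<close>
  define H where "H = (cmod h')\<^sup>2 + (cmod R')\<^sup>2 + q\<^sup>2 * (cmod h)\<^sup>2 + q\<^sup>2 * (cmod R)\<^sup>2"
  have H0: "H \<ge> 0" by (auto simp: H_def)
  have "cmod ((h' * R + h * R') * cnj D / S\<^sup>2) \<le> H / (2 * \<eta> ^ 3)"
  proof -
    have "cmod ((h' * R + h * R') * cnj D / S\<^sup>2) = cmod (h' * R + h * R') * cmod D / p ^ 4"
      by (simp add: S' norm_mult norm_divide norm_power)
    also have "\<dots> \<le> (cmod h' * cmod R + cmod h * cmod R') * (p * q) / p ^ 4"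
      by (intro divide_right_mono mult_mono D' order_trans[OF norm_triangle_ineq]) (auto simp: norm_mult)
    also have "\<dots> = (cmod h' * (q * cmod R) + (q * cmod h) * cmod R') / p ^ 3"
      using p0 by (simp add: field_simps power_eq_if)
    also have "\<dots> \<le> (H / 2) / p ^ 3"
    proof (intro divide_right_mono)
      show "cmod h' * (q * cmod R) + (q * cmod h) * cmod R' \<le> H / 2"
        using sum_squares_bound[of "cmod h'" "q * cmod R"] sum_squares_bound[of "q * cmod h" "cmod R'"]
        by (simp add: H_def power_mult_distrib)
    qed (use p0 in auto)
    also have "\<dots> \<le> (H / 2) / \<eta> ^ 3"
      by (intro divide_left_mono power_mono) (use p eta p0 H0 in auto)
    finally show ?thesis by simp
  qed
  moreover have "cmod (2 * h * R * cnj D * s / S ^ 3) \<le> H / \<eta> ^ 4"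
  proof -
    have "cmod (2 * h * R * cnj D * s / S ^ 3) = 2 * cmod h * cmod R * cmod D * cmod s / p ^ 6"
      by (simp add: S' norm_mult norm_divide norm_power)
    also have "\<dots> \<le> 2 * cmod h * cmod R * (p * q) * (p * q) / p ^ 6"
      by (intro divide_right_mono mult_mono D' s') (use p0 q in auto)
    also have "\<dots> = (2 * (q * cmod h) * (q * cmod R)) / p ^ 4"
      using p0 by (simp add: field_simps power_eq_if)
    also have "\<dots> \<le> H / p ^ 4"
    proof (intro divide_right_mono)
      show "2 * (q * cmod h) * (q * cmod R) \<le> H"
        using sum_squares_bound[of "q * cmod h" "q * cmod R"]
          zero_le_power2[of "cmod h'"] zero_le_power2[of "cmod R'"]
        unfolding H_def power_mult_distrib by linarith
    qed (use p0 in auto)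
    also have "\<dots> \<le> H / \<eta> ^ 4"
      by (intro divide_left_mono power_mono) (use p eta p0 H0 in auto)
    finally show ?thesis by simp
  qed
  ultimately have "cmod ((h' * R + h * R') * cnj D / S\<^sup>2 - 2 * h * R * cnj D * s / S ^ 3)
      \<le> H / (2 * \<eta> ^ 3) + H / \<eta> ^ 4"
    by (intro order_trans[OF norm_triangle_ineq4] add_mono)
  also have "\<dots> = (1 / (2 * \<eta> ^ 3) + 1 / \<eta> ^ 4) * H" by (simp add: algebra_simps)
  also have "\<dots> \<le> (1 / (2 * \<eta> ^ 3) + 1 / \<eta> ^ 4) * ((2 + 4 * M\<^sup>2) * ((cmod h')\<^sup>2 + (cmod (p1' * h + p1 * h'))\<^sup>2 + (cmod (p2' * h + p2 * h'))\<^sup>2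
        + (cmod R')\<^sup>2 + (cmod (p1' * R + p1 * R'))\<^sup>2 + (cmod (p2' * R + p2 * R'))\<^sup>2))"
  proof (intro mult_left_mono)
    \<comment> \<open>The product rule read backwards: \<open>p' * g\<close> is the derivative of
      \<open>pp * g\<close> minus \<open>pp * g'\<close>, so the weights \<open>q\<close> can be
      removed from \<open>H\<close>.\<close>
    have *: "(cmod p')\<^sup>2 * (cmod g)\<^sup>2 \<le> 2 * (cmod (p' * g + pp * g'))\<^sup>2 + 2 * M\<^sup>2 * (cmod g')\<^sup>2"
      if "cmod pp \<le> M" for p' pp g g'
    proof -
      have "(cmod p')\<^sup>2 * (cmod g)\<^sup>2 = (cmod ((p' * g + pp * g') + (- (pp * g'))))\<^sup>2"
        by (simp add: norm_mult power_mult_distrib)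
      also have "\<dots> \<le> 2 * (cmod (p' * g + pp * g'))\<^sup>2 + 2 * (cmod (pp * g'))\<^sup>2"
        using cmod_add_sq_le[of "p' * g + pp * g'" "- (pp * g')"] by simp
      also have "(cmod (pp * g'))\<^sup>2 \<le> M\<^sup>2 * (cmod g')\<^sup>2"
        unfolding norm_mult power_mult_distrib using that by (intro mult_right_mono power_mono) auto
      finally show ?thesis by simp
    qed
    have "q\<^sup>2 * (cmod g)\<^sup>2 \<le> 2 * (cmod (p1' * g + p1 * g'))\<^sup>2 + 2 * (cmod (p2' * g + p2 * g'))\<^sup>2
        + 4 * M\<^sup>2 * (cmod g')\<^sup>2" for g g'
      using *[OF M(1), of p1' g g'] *[OF M(2), of p2' g g'] by (simp add: q2 algebra_simps)
    from this[of h h'] this[of R R']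
    have "H \<le> 2 * ((cmod (p1' * h + p1 * h'))\<^sup>2 + (cmod (p2' * h + p2 * h'))\<^sup>2 + (cmod (p1' * R + p1 * R'))\<^sup>2 + (cmod (p2' * R + p2 * R'))\<^sup>2)
       + (1 + 4 * M\<^sup>2) * ((cmod h')\<^sup>2 + (cmod R')\<^sup>2)"
      unfolding H_def by (simp add: algebra_simps)
    also have "\<dots> \<le> (2 + 4 * M\<^sup>2) * ((cmod (p1' * h + p1 * h'))\<^sup>2 + (cmod (p2' * h + p2 * h'))\<^sup>2 + (cmod (p1' * R + p1 * R'))\<^sup>2 + (cmod (p2' * R + p2 * R'))\<^sup>2)
       + (2 + 4 * M\<^sup>2) * ((cmod h')\<^sup>2 + (cmod R')\<^sup>2)"
      by (intro add_mono mult_right_mono) auto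
    finally show "H \<le> (2 + 4 * M\<^sup>2) * ((cmod h')\<^sup>2 + (cmod (p1' * h + p1 * h'))\<^sup>2 + (cmod (p2' * h + p2 * h'))\<^sup>2
        + (cmod R')\<^sup>2 + (cmod (p1' * R + p1 * R'))\<^sup>2 + (cmod (p2' * R + p2 * R'))\<^sup>2)"
      by (simp add: algebra_simps)
  qed (use eta in auto)
  finally show ?thesis by (simp add: corona_K_def mult.assoc)
qed

text \<open>The real part of \<open>W = V - \<kappa> G\<close> has nonnegative Laplacian by
  \<open>corona_pointwise\<close>, and it is nonnegative at the origin since \<open>R1\<close> and
  \<open>R2\<close> vanish there. The sub-mean value property therefore bounds the mean of
  \<open>\<kappa> G\<close> by that of \<open>V\<close>, which Parseval turns into squared
  norms.\<close>

lemma corona_cmean: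
  fixes P1 P2 h R1 R2 :: "complex poly"
  defines "R \<equiv> P2 * R1 - P1 * R2"
  defines "S \<equiv> \<lambda>z. poly P1 z * cnj (poly P1 z) + poly P2 z * cnj (poly P2 z)"
  assumes eta: "\<eta> > 0" "\<And>z. cmod z \<le> 1 \<Longrightarrow> \<eta>\<^sup>2 \<le> (cmod (poly P1 z))\<^sup>2 + (cmod (poly P2 z))\<^sup>2"
    and M: "\<And>z. cmod z \<le> 1 \<Longrightarrow> cmod (poly P1 z) \<le> M" "\<And>z. cmod z \<le> 1 \<Longrightarrow> cmod (poly P2 z) \<le> M"
    and R0: "poly R1 0 = 0" "poly R2 0 = 0"
  shows "cmod (cmean (\<lambda>z. poly h z * (cnj (poly P1 z) * poly R1 z + cnj (poly P2 z) * poly R2 z) * inverse (S z)))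
     \<le> corona_K \<eta> M * (1 + 2 * M\<^sup>2) * (l2_sq (fps_of_poly h) + l2_sq (fps_of_poly R))"
proof -
  define N where "N z = cnj (poly P1 z) * poly R1 z + cnj (poly P2 z) * poly R2 z" for z
  define G where "G z = poly h z * N z * inverse (S z)" for z
  define K where "K = corona_K \<eta> M"
  define gs where "gs = [h, P1 * h, P2 * h, R, P1 * R, P2 * R]"
  define V where "V z = of_real K * (\<Sum>g\<leftarrow>gs. poly g z * cnj (poly g z))" for z
  \<comment> \<open>\<open>\<kappa>\<close> rotates the mean of \<open>G\<close> onto its modulus.
    As \<open>sgn 0 = 0\<close>, it may be zero, so only \<open>cmod \<kappa> \<le> 1\<close> is
    recorded.\<close>
  define \<kappa> where "\<kappa> = cnj (sgn (cmean G))"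
  define W where "W z = V z - \<kappa> * G z" for z
  define D where "D = pderiv P1 * P2 - P1 * pderiv P2"
  define s where "s z = poly (pderiv P1) z * cnj (poly P1 z) + poly (pderiv P2) z * cnj (poly P2 z)" for z
  have K0: "K \<ge> 0" using eta by (simp add: K_def corona_K_def)
  have k1: "cmod \<kappa> \<le> 1" by (simp add: \<kappa>_def norm_sgn)
  have S0: "S z \<noteq> 0" if "cmod z \<le> 1" for z
  proof -
    have "S z = of_real ((cmod (poly P1 z))\<^sup>2 + (cmod (poly P2 z))\<^sup>2)"
      unfolding S_def of_real_add of_real_cmod_squared ..
    moreover have "\<eta>\<^sup>2 > 0" using eta by simp
    ultimately show ?thesis using eta(2)[OF that] by (metis not_less of_real_eq_0_iff)
  qed
  define aG where "aG z = (poly (pderiv h) z * N z + poly h z * (cnj (poly P1 z) * poly (pderiv R1) z + cnj (poly P2 z) * poly (pderiv R2) z)) * inverse (S z)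
      + poly h z * N z * (- s z / (S z)\<^sup>2)" for z
  define bG where "bG z = poly h z * poly R z * cnj (poly D z) * (inverse (S z) * inverse (S z))" for z
  define cG where "cG z = (poly (pderiv h) z * poly R z + poly h z * poly (pderiv R) z) * cnj (poly D z) / (S z)\<^sup>2
      - 2 * poly h z * poly R z * cnj (poly D z) * s z / (S z) ^ 3" for z
  define dG where "dG z = poly h z * poly R z * cnj (poly (pderiv D) z) * (inverse (S z) * inverse (S z))
      + poly h z * poly R z * cnj (poly D z) * (- 2 * cnj (s z) / (S z) ^ 3)" for z
  have wS: "has_wirtinger S (s z) (cnj (s z)) z" for z
    unfolding S_def s_def
    by (rule has_wirtinger_eqI, rule has_wirtinger_add[OF has_wirtinger_mult[OF has_wirtinger_poly has_wirtinger_cnj_poly] has_wirtinger_mult[OF has_wirtinger_poly has_wirtinger_cnj_poly]])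
       (auto simp: algebra_simps)
  have wN: "has_wirtinger N (cnj (poly P1 z) * poly (pderiv R1) z + cnj (poly P2 z) * poly (pderiv R2) z)
      (cnj (poly (pderiv P1) z) * poly R1 z + cnj (poly (pderiv P2) z) * poly R2 z) z" for z
    unfolding N_def
    by (rule has_wirtinger_eqI, rule has_wirtinger_add[OF has_wirtinger_mult[OF has_wirtinger_cnj_poly has_wirtinger_poly] has_wirtinger_mult[OF has_wirtinger_cnj_poly has_wirtinger_poly]])
       (auto simp: algebra_simps)
  have wG: "has_wirtinger G (aG z) (bG z) z" if z: "cmod z \<le> 1" for z
    unfolding G_def
  proof (rule has_wirtinger_eqI, rule has_wirtinger_mult[OF has_wirtinger_mult[OF has_wirtinger_poly wN] has_wirtinger_inverse[OF wS S0[OF z]]])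
    \<comment> \<open>The numerator of the quotient rule in \<open>cnj z\<close> factors into two
      determinants, \<open>R\<close> and the conjugate of \<open>D\<close>. This is why
      \<open>bG\<close> contains \<open>R1\<close> and \<open>R2\<close> only through
      \<open>R\<close>.\<close>
    have "(cnj (poly (pderiv P1) z) * poly R1 z + cnj (poly (pderiv P2) z) * poly R2 z) * S z - N z * cnj (s z)
        = poly R z * cnj (poly D z)"
      by (simp add: S_def N_def s_def R_def D_def algebra_simps)
    then have eq: "cnj (poly (pderiv P1) z) * poly R1 z + cnj (poly (pderiv P2) z) * poly R2 z
        = (poly R z * cnj (poly D z) + N z * cnj (s z)) / S z"
      using S0[OF z] by (simp add: field_simps)
    show "(0 * N z + poly h z * (cnj (poly (pderiv P1) z) * poly R1 z + cnj (poly (pderiv P2) z) * poly R2 z)) * inverse (S z) +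
        poly h z * N z * (- cnj (s z) / (S z)\<^sup>2) = bG z"
      unfolding eq bG_def using S0[OF z] by (simp add: field_simps power2_eq_square)
  qed (simp add: aG_def)
  have wbG: "has_wirtinger bG (cG z) (dG z) z" if z: "cmod z \<le> 1" for z
    unfolding bG_def
    by (rule has_wirtinger_eqI, rule has_wirtinger_mult[OF has_wirtinger_mult[OF has_wirtinger_mult[OF has_wirtinger_poly has_wirtinger_poly] has_wirtinger_cnj_poly]
          has_wirtinger_mult[OF has_wirtinger_inverse[OF wS S0[OF z]] has_wirtinger_inverse[OF wS S0[OF z]]]])
       (use S0[OF z] in \<open>auto simp: cG_def dG_def field_simps power2_eq_square power3_eq_cube\<close>)
  define aV where "aV z = of_real K * (\<Sum>g\<leftarrow>gs. poly (pderiv g) z * cnj (poly g z))" for z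
  define bV where "bV z = of_real K * (\<Sum>g\<leftarrow>gs. poly g z * cnj (poly (pderiv g) z))" for z
  define cV where "cV z = of_real K * (\<Sum>g\<leftarrow>gs. poly (pderiv g) z * cnj (poly (pderiv g) z))" for z
  define dV where "dV z = of_real K * (\<Sum>g\<leftarrow>gs. poly g z * cnj (poly (pderiv (pderiv g)) z))" for z
  have wV: "has_wirtinger V (aV z) (bV z) z" for z
    unfolding V_def aV_def bV_def
    by (intro has_wirtinger_cmult has_wirtinger_sum_list has_wirtinger_eqI[OF has_wirtinger_mult[OF has_wirtinger_poly has_wirtinger_cnj_poly]]) auto
  have wbV: "has_wirtinger bV (cV z) (dV z) z" for z
    unfolding bV_def cV_def dV_def
    by (intro has_wirtinger_cmult has_wirtinger_sum_list has_wirtinger_eqI[OF has_wirtinger_mult[OF has_wirtinger_poly has_wirtinger_cnj_poly]]) auto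
  have "Re (W 0) \<le> Re (cmean W)"
  proof (rule sub_mean_value)
    fix z :: complex assume "z \<in> ball 0 1"
    then have z: "cmod z \<le> 1" by auto
    show "has_wirtinger W (aV z - \<kappa> * aG z) (bV z - \<kappa> * bG z) z"
      unfolding W_def by (intro has_wirtinger_diff has_wirtinger_cmult wV wG z)
    show "has_wirtinger (\<lambda>z. bV z - \<kappa> * bG z) (cV z - \<kappa> * cG z) (dV z - \<kappa> * dG z) z"
      by (intro has_wirtinger_diff has_wirtinger_cmult wbV wbG z)
    have "Re (\<kappa> * cG z) \<le> cmod \<kappa> * cmod (cG z)"
      using complex_Re_le_cmod[of "\<kappa> * cG z"] by (simp add: norm_mult)
    also have "\<dots> \<le> cmod (cG z)" using k1 by (simp add: mult_left_le_one_le)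
    also have "\<dots> \<le> K * ((cmod (poly (pderiv h) z))\<^sup>2
        + (cmod (poly (pderiv P1) z * poly h z + poly P1 z * poly (pderiv h) z))\<^sup>2
        + (cmod (poly (pderiv P2) z * poly h z + poly P2 z * poly (pderiv h) z))\<^sup>2
        + (cmod (poly (pderiv R) z))\<^sup>2
        + (cmod (poly (pderiv P1) z * poly R z + poly P1 z * poly (pderiv R) z))\<^sup>2
        + (cmod (poly (pderiv P2) z * poly R z + poly P2 z * poly (pderiv R) z))\<^sup>2)"
      unfolding cG_def K_def
      by (rule corona_pointwise[of "S z" "poly P1 z" "poly P2 z"])
         (auto simp: S_def s_def D_def eta(1) eta(2)[OF z] M[OF z])
    also have "\<dots> = K * (\<Sum>g\<leftarrow>gs. (cmod (poly (pderiv g) z))\<^sup>2)"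
      by (simp add: gs_def pderiv_mult algebra_simps)
    also have "\<dots> = Re (of_real (K * (\<Sum>g\<leftarrow>gs. (cmod (poly (pderiv g) z))\<^sup>2)))"
      by simp
    also have "of_real (K * (\<Sum>g\<leftarrow>gs. (cmod (poly (pderiv g) z))\<^sup>2)) = cV z"
      by (simp add: cV_def gs_def of_real_cmod_squared del: of_real_power)
    finally show "Re (cV z - \<kappa> * cG z) \<ge> 0" by simp
  next
    show "continuous_on (ball 0 1) (\<lambda>z. aV z - \<kappa> * aG z)"
      unfolding aV_def aG_def gs_def S_def N_def s_def
      by (simp, intro continuous_intros) (use S0 in \<open>auto simp: S_def\<close>)
    show "continuous_on (ball 0 1) (\<lambda>z. cV z - \<kappa> * cG z)"
      unfolding cV_def cG_def gs_def S_def N_def s_def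
      by (simp, intro continuous_intros) (use S0 in \<open>auto simp: S_def\<close>)
    show "continuous_on (ball 0 1) (\<lambda>z. dV z - \<kappa> * dG z)"
      unfolding dV_def dG_def gs_def S_def N_def s_def
      by (simp, intro continuous_intros) (use S0 in \<open>auto simp: S_def\<close>)
    show "continuous_on (cball 0 1) W"
      unfolding W_def V_def G_def gs_def S_def N_def
      by (simp, intro continuous_intros) (use S0 in \<open>auto simp: S_def\<close>)
  qed
  moreover have "Re (W 0) \<ge> 0"
  proof -
    have "V 0 = of_real (K * (\<Sum>g\<leftarrow>gs. (cmod (poly g 0))\<^sup>2))"
      by (simp add: V_def gs_def of_real_cmod_squared del: of_real_power)
    moreover have "(\<Sum>g\<leftarrow>gs. (cmod (poly g 0))\<^sup>2) \<ge> 0" by (simp add: gs_def)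
    moreover have "G 0 = 0" by (simp add: G_def N_def R0)
    ultimately show ?thesis using K0 by (simp add: W_def)
  qed
  moreover have "cmean W = of_real (K * (\<Sum>g\<leftarrow>gs. l2_sq (fps_of_poly g))) - of_real (cmod (cmean G))"
  proof -
    have contG: "circle_cont G"
      unfolding circle_cont_def G_def S_def N_def
      by (intro continuous_intros) (use S0 in \<open>auto simp: S_def\<close>)
    have contV: "circle_cont V"
      unfolding circle_cont_def V_def gs_def by (simp, intro continuous_intros)
    have "cmean W = cmean V - \<kappa> * cmean G"
      unfolding W_def by (subst cmean_diff) (auto simp: contV contG cmean_cmult circle_cont_def[of "\<lambda>z. c * _ z" for c] intro!: continuous_intros contG[unfolded circle_cont_def])
    moreover have "\<kappa> * cmean G = of_real (cmod (cmean G))"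
      unfolding \<kappa>_def sgn_eq
      using of_real_cmod_squared[of "cmean G"] by (simp add: power2_eq_square mult.commute divide_simps)
    moreover have "cmean V = of_real (K * (\<Sum>g\<leftarrow>gs. l2_sq (fps_of_poly g)))"
    proof -
      have "cmean V = of_real K * (\<Sum>g\<leftarrow>gs. cmean (\<lambda>z. poly g z * cnj (poly g z)))"
        unfolding V_def cmean_cmult using cmean_sum_list[of gs "\<lambda>g z. poly g z * cnj (poly g z)"] by simp
      then show ?thesis
        by (simp add: gs_def parseval_poly l2_inner_self l2_poly)
    qed
    ultimately show ?thesis by simp
  qed
  ultimately have "cmod (cmean G) \<le> K * (\<Sum>g\<leftarrow>gs. l2_sq (fps_of_poly g))"
    by simp
  also have "(\<Sum>g\<leftarrow>gs. l2_sq (fps_of_poly g)) \<le> (1 + 2 * M\<^sup>2) * (l2_sq (fps_of_poly h) + l2_sq (fps_of_poly R))"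
  proof -
    have "l2_sq (fps_of_poly (P1 * g)) \<le> M\<^sup>2 * l2_sq (fps_of_poly g)" "l2_sq (fps_of_poly (P2 * g)) \<le> M\<^sup>2 * l2_sq (fps_of_poly g)" for g
      using M by (auto intro: l2_sq_poly_mult_le)
    from this[of h] this[of R] show ?thesis by (simp add: gs_def algebra_simps)
  qed
  finally have "cmod (cmean G) \<le> K * (1 + 2 * M\<^sup>2) * (l2_sq (fps_of_poly h) + l2_sq (fps_of_poly R))"
    using K0 by (simp add: mult.assoc mult_left_mono)
  then show ?thesis
    unfolding K_def G_def[abs_def] N_def .
qed

text \<open>After division by \<open>S\<close>, the squared modulus of \<open>k\<close> on the
  circle is \<open>F + G\<close>, where \<open>F\<close> carries \<open>p1\<close>,
  \<open>p2\<close> and \<open>G\<close> carries \<open>R1\<close>, \<open>R2\<close>. Each mean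
  costs a quarter of the squared norm of \<open>k\<close>, which is absorbed on the left; the
  remainder is a multiple of the squared norms of \<open>p1\<close> and \<open>p2\<close>.\<close>

lemma corona_poly:
  fixes P1 P2 k :: "complex poly"
  assumes eta: "\<eta> > 0" "\<And>z. cmod z \<le> 1 \<Longrightarrow> \<eta>\<^sup>2 \<le> (cmod (poly P1 z))\<^sup>2 + (cmod (poly P2 z))\<^sup>2"
    and M: "\<And>z. cmod z \<le> 1 \<Longrightarrow> cmod (poly P1 z) \<le> M" "\<And>z. cmod z \<le> 1 \<Longrightarrow> cmod (poly P2 z) \<le> M"
    and p: "\<And>n. coeff p1 n = l2_inner (fps_of_poly k) (fps_of_poly P1 * fps_X ^ n)"
      "\<And>n. coeff p2 n = l2_inner (fps_of_poly k) (fps_of_poly P2 * fps_X ^ n)"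
  defines "C \<equiv> corona_K \<eta> M * (1 + 2 * M\<^sup>2)"
  shows "l2_sq (fps_of_poly k) \<le> (2 / \<eta>\<^sup>2 + 16 * C\<^sup>2 * M\<^sup>2) * (l2_sq (fps_of_poly p1) + l2_sq (fps_of_poly p2))"
proof -
  obtain q1 R1 where R1: "poly R1 0 = 0"
    and e1': "\<And>z. cmod z = 1 \<Longrightarrow> poly P1 z * cnj (poly k z) = cnj (poly q1 z) + poly R1 z"
    using circle_split by blast
  obtain q2 R2 where R2: "poly R2 0 = 0"
    and e2': "\<And>z. cmod z = 1 \<Longrightarrow> poly P2 z * cnj (poly k z) = cnj (poly q2 z) + poly R2 z"
    using circle_split by blast
  have "q1 = p1" "q2 = p2"
    using circle_split_coeff[OF R1 e1'] circle_split_coeff[OF R2 e2'] p by (auto intro: poly_eqI)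
  note e1 = e1'[unfolded this] and e2 = e2'[unfolded this]
  define R where "R = P2 * R1 - P1 * R2"
  define S where "S z = poly P1 z * cnj (poly P1 z) + poly P2 z * cnj (poly P2 z)" for z
  have SR: "S z = of_real ((cmod (poly P1 z))\<^sup>2 + (cmod (poly P2 z))\<^sup>2)" for z
    unfolding S_def of_real_add of_real_cmod_squared ..
  have eta2: "\<eta>\<^sup>2 > 0" using eta by simp
  have S0: "S z \<noteq> 0" if "cmod z \<le> 1" for z
    using eta(2)[OF that] eta2 SR[of z] by (metis not_less of_real_eq_0_iff)
  define F where "F z = poly k z * (cnj (poly P1 z) * cnj (poly p1 z) + cnj (poly P2 z) * cnj (poly p2 z)) * inverse (S z)" for z
  define G where "G z = poly k z * (cnj (poly P1 z) * poly R1 z + cnj (poly P2 z) * poly R2 z) * inverse (S z)" for z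
  have contF: "circle_cont F" and contG: "circle_cont G"
    unfolding circle_cont_def F_def G_def S_def
    by (intro continuous_intros; use S0 in \<open>auto simp: S_def\<close>)+
  have M0: "M \<ge> 0" using M(1)[of 0] by (smt (verit) norm_ge_zero norm_zero)
  have C0: "C > 0"
  proof -
    have "1 / (2 * \<eta> ^ 3) + 1 / \<eta> ^ 4 > 0" using eta by (intro add_pos_pos) auto
    moreover have "2 + 4 * M\<^sup>2 > 0" "1 + 2 * M\<^sup>2 > 0" by (intro add_pos_nonneg; simp)+
    ultimately show ?thesis unfolding C_def corona_K_def by simp
  qed
  have sqk: "of_real (l2_sq (fps_of_poly k)) = cmean F + cmean G"
  proof -
    have "of_real (l2_sq (fps_of_poly k)) = cmean (\<lambda>z. poly k z * cnj (poly k z))"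
      by (simp add: parseval_poly l2_inner_self l2_poly)
    also have "\<dots> = cmean (\<lambda>z. F z + G z)"
    proof (rule cmean_cong)
      fix z :: complex assume z: "cmod z = 1"
      have "F z + G z = poly k z * (cnj (poly P1 z) * (cnj (poly p1 z) + poly R1 z) + cnj (poly P2 z) * (cnj (poly p2 z) + poly R2 z)) * inverse (S z)"
        by (simp add: F_def G_def algebra_simps)
      also have "\<dots> = (poly k z * cnj (poly k z)) * (S z * inverse (S z))"
        unfolding e1[OF z, symmetric] e2[OF z, symmetric] by (simp add: S_def algebra_simps)
      finally show "poly k z * cnj (poly k z) = F z + G z"
        using S0[of z] z by simp
    qed
    finally show ?thesis by (simp add: cmean_add contF contG)
  qed
  have boundF: "cmod (cmean F) \<le> l2_sq (fps_of_poly k) / 4 + (l2_sq (fps_of_poly p1) + l2_sq (fps_of_poly p2)) / \<eta>\<^sup>2"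
  proof -
    let ?H = "\<lambda>z. of_real (1/4) * (poly k z * cnj (poly k z)) + of_real (1/\<eta>\<^sup>2) * (poly p1 z * cnj (poly p1 z) + poly p2 z * cnj (poly p2 z))"
    have "cmod (cmean F) \<le> Re (cmean ?H)"
    proof (rule cmean_norm_le[OF contF])
      show "circle_cont ?H" unfolding circle_cont_def by (intro continuous_intros)
      fix z :: complex assume z: "cmod z = 1"
      define a where "a = sqrt ((cmod (poly P1 z))\<^sup>2 + (cmod (poly P2 z))\<^sup>2)"
      define b where "b = sqrt ((cmod (poly p1 z))\<^sup>2 + (cmod (poly p2 z))\<^sup>2)"
      have a: "a \<ge> \<eta>" unfolding a_def using eta z real_le_rsqrt by auto
      have a2: "a\<^sup>2 = (cmod (poly P1 z))\<^sup>2 + (cmod (poly P2 z))\<^sup>2" and b2: "b\<^sup>2 = (cmod (poly p1 z))\<^sup>2 + (cmod (poly p2 z))\<^sup>2"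
        and b0: "b \<ge> 0"
        by (auto simp: a_def b_def)
      have "cmod (cnj (poly P1 z) * cnj (poly p1 z) + cnj (poly P2 z) * cnj (poly p2 z)) \<le>
          cmod (poly P1 z) * cmod (poly p1 z) + cmod (poly P2 z) * cmod (poly p2 z)"
        by (rule order_trans[OF norm_triangle_ineq]) (simp add: norm_mult)
      also have "\<dots> \<le> a * b" unfolding a_def b_def by (rule cauchy_schwarz_real2)
      finally have ab: "cmod (cnj (poly P1 z) * cnj (poly p1 z) + cnj (poly P2 z) * cnj (poly p2 z)) \<le> a * b" .
      have "cmod (F z) = cmod (poly k z) * cmod (cnj (poly P1 z) * cnj (poly p1 z) + cnj (poly P2 z) * cnj (poly p2 z)) / a\<^sup>2"
        unfolding F_def SR a2[symmetric] by (simp add: norm_mult norm_inverse divide_inverse norm_power)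
      also have "\<dots> \<le> cmod (poly k z) * (a * b) / a\<^sup>2"
        by (intro divide_right_mono mult_left_mono ab) auto
      also have "\<dots> = cmod (poly k z) * (b / a)"
        using a eta by (simp add: power2_eq_square)
      also have "\<dots> \<le> cmod (poly k z) * (b / \<eta>)"
        by (intro mult_left_mono divide_left_mono) (use a eta b0 in auto)
      also have "\<dots> \<le> (cmod (poly k z))\<^sup>2 / 4 + (b / \<eta>)\<^sup>2"
        using sum_squares_bound[of "cmod (poly k z) / 2" "b / \<eta>"] by (simp add: power_divide)
      also have "\<dots> = Re (of_real ((cmod (poly k z))\<^sup>2 / 4 + b\<^sup>2 / \<eta>\<^sup>2))"
        by (simp add: power_divide)
      also have "of_real ((cmod (poly k z))\<^sup>2 / 4 + b\<^sup>2 / \<eta>\<^sup>2) = ?H z"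
        unfolding b2 of_real_cmod_squared[symmetric] by simp
      finally show "cmod (F z) \<le> Re (?H z)" .
    qed
    also have "cmean ?H = of_real (l2_sq (fps_of_poly k) / 4 + (l2_sq (fps_of_poly p1) + l2_sq (fps_of_poly p2)) / \<eta>\<^sup>2)"
    proof -
      have "cmean ?H = of_real (1/4) * cmean (\<lambda>z. poly k z * cnj (poly k z)) + of_real (1/\<eta>\<^sup>2) * (cmean (\<lambda>z. poly p1 z * cnj (poly p1 z)) + cmean (\<lambda>z. poly p2 z * cnj (poly p2 z)))"
        by (simp only: cmean_cmult cmean_add circle_cont_poly circle_cont_mult circle_cont_const circle_cont_add)
      then show ?thesis by (simp add: parseval_poly l2_inner_self l2_poly)
    qed
    finally show ?thesis by simp
  qed
  have boundG: "cmod (cmean G) \<le> l2_sq (fps_of_poly k) / 4 + 4 * C\<^sup>2 * l2_sq (fps_of_poly R)"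
  proof -
    \<comment> \<open>The left side of \<open>corona_cmean\<close> is linear in \<open>h\<close>,
      the right side is not. With \<open>h\<close> equal to \<open>l\<close> times \<open>k\<close>,
      division by \<open>l\<close> gives the squared norm of \<open>k\<close> the weight
      \<open>C * l = 1 / 4\<close> and that of \<open>R\<close> the weight
      \<open>C / l = 4 * C * C\<close>.\<close>
    define l where "l = 1 / (4 * C)"
    have l0: "l > 0" using C0 by (simp add: l_def)
    have "cmean (\<lambda>z. poly (smult (of_real l) k) z * (cnj (poly P1 z) * poly R1 z + cnj (poly P2 z) * poly R2 z) * inverse (S z))
        = of_real l * cmean G"
      unfolding cmean_cmult[symmetric] G_def by (simp add: mult.assoc)
    with corona_cmean[OF eta M R1 R2, of "smult (of_real l) k"]
    have "l * cmod (cmean G) \<le> C * (l2_sq (fps_of_poly (smult (of_real l) k)) + l2_sq (fps_of_poly R))"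
      using l0 by (simp add: norm_mult C_def S_def R_def)
    also have "l2_sq (fps_of_poly (smult (of_real l) k)) = l\<^sup>2 * l2_sq (fps_of_poly k)"
      by (simp add: fps_of_poly_smult l2_sq_cmult l2_poly)
    finally have "4 * C * (l * cmod (cmean G)) \<le> 4 * C * (C * (l\<^sup>2 * l2_sq (fps_of_poly k) + l2_sq (fps_of_poly R)))"
      using C0 by simp
    moreover have "4 * C * (l * x) = x" for x using C0 by (simp add: l_def)
    moreover have "4 * C * (C * (l\<^sup>2 * x + y)) = x / 4 + 4 * C\<^sup>2 * y" for x y
      using C0 by (simp add: l_def field_simps power2_eq_square)
    ultimately show ?thesis by simp
  qed
  have boundR: "l2_sq (fps_of_poly R) \<le> 2 * M\<^sup>2 * (l2_sq (fps_of_poly p1) + l2_sq (fps_of_poly p2))"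
  proof -
    let ?H = "\<lambda>z. of_real (2 * M\<^sup>2) * (poly p1 z * cnj (poly p1 z) + poly p2 z * cnj (poly p2 z))"
    have "cmod (cmean (\<lambda>z. poly R z * cnj (poly R z))) \<le> Re (cmean ?H)"
    proof (rule cmean_norm_le)
      show "circle_cont ?H" unfolding circle_cont_def by (intro continuous_intros)
      fix z :: complex assume z: "cmod z = 1"
      have r1: "poly R1 z = poly P1 z * cnj (poly k z) - cnj (poly p1 z)" using e1[OF z] by simp
      have r2: "poly R2 z = poly P2 z * cnj (poly k z) - cnj (poly p2 z)" using e2[OF z] by simp
      \<comment> \<open>The terms with \<open>cnj k\<close> cancel in
        \<open>P2 * R1 - P1 * R2\<close>, leaving only the adjoint images \<open>p1\<close> and
        \<open>p2\<close>.\<close>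
      have "poly R z = poly P1 z * cnj (poly p2 z) + - (poly P2 z * cnj (poly p1 z))"
        by (simp add: R_def r1 r2 algebra_simps)
      then have "(cmod (poly R z))\<^sup>2 \<le> 2 * (cmod (poly P1 z) * cmod (poly p2 z))\<^sup>2 + 2 * (cmod (poly P2 z) * cmod (poly p1 z))\<^sup>2"
        using cmod_add_sq_le[of "poly P1 z * cnj (poly p2 z)" "- (poly P2 z * cnj (poly p1 z))"] by (simp add: norm_mult)
      also have "\<dots> \<le> 2 * (M\<^sup>2 * (cmod (poly p2 z))\<^sup>2) + 2 * (M\<^sup>2 * (cmod (poly p1 z))\<^sup>2)"
        unfolding power_mult_distrib using M[of z] z by (intro add_mono mult_left_mono mult_right_mono power_mono) auto
      also have "\<dots> = Re (of_real (2 * M\<^sup>2 * ((cmod (poly p1 z))\<^sup>2 + (cmod (poly p2 z))\<^sup>2)))"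
        by (simp add: algebra_simps)
      also have "of_real (2 * M\<^sup>2 * ((cmod (poly p1 z))\<^sup>2 + (cmod (poly p2 z))\<^sup>2)) = ?H z"
        unfolding of_real_cmod_squared[symmetric] by simp
      finally show "cmod (poly R z * cnj (poly R z)) \<le> Re (?H z)"
        by (simp add: norm_mult power2_eq_square)
    qed auto
    also have "cmean ?H = of_real (2 * M\<^sup>2 * (l2_sq (fps_of_poly p1) + l2_sq (fps_of_poly p2)))"
    proof -
      have "cmean ?H = of_real (2 * M\<^sup>2) * (cmean (\<lambda>z. poly p1 z * cnj (poly p1 z)) + cmean (\<lambda>z. poly p2 z * cnj (poly p2 z)))"
        by (simp only: cmean_cmult cmean_add circle_cont_poly circle_cont_mult)
      then show ?thesis by (simp add: parseval_poly l2_inner_self l2_poly)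
    qed
    finally show ?thesis by (simp add: parseval_poly l2_inner_self l2_poly l2_sq_nonneg)
  qed
  have "l2_sq (fps_of_poly k) \<le> cmod (cmean F) + cmod (cmean G)"
  proof -
    have "l2_sq (fps_of_poly k) = cmod (of_real (l2_sq (fps_of_poly k)))" by (simp add: l2_sq_nonneg l2_poly)
    then show ?thesis unfolding sqk using norm_triangle_ineq by metis
  qed
  also have "\<dots> \<le> l2_sq (fps_of_poly k) / 2 + (l2_sq (fps_of_poly p1) + l2_sq (fps_of_poly p2)) / \<eta>\<^sup>2
      + 4 * C\<^sup>2 * l2_sq (fps_of_poly R)"
    using boundF boundG by linarith
  also have "4 * C\<^sup>2 * l2_sq (fps_of_poly R) \<le> 4 * C\<^sup>2 * (2 * M\<^sup>2 * (l2_sq (fps_of_poly p1) + l2_sq (fps_of_poly p2)))"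
    by (intro mult_left_mono boundR) auto
  finally have *: "l2_sq (fps_of_poly k) \<le> l2_sq (fps_of_poly k) / 2 + ((l2_sq (fps_of_poly p1) + l2_sq (fps_of_poly p2)) / \<eta>\<^sup>2
      + 4 * C\<^sup>2 * (2 * M\<^sup>2 * (l2_sq (fps_of_poly p1) + l2_sq (fps_of_poly p2))))" by simp
  have eq: "(2 / \<eta>\<^sup>2 + 16 * C\<^sup>2 * M\<^sup>2) * x = 2 * (x / \<eta>\<^sup>2 + 4 * C\<^sup>2 * (2 * M\<^sup>2 * x))" for x
    by (simp add: algebra_simps)
  have "x \<le> x / 2 + y \<Longrightarrow> x \<le> 2 * y" for x y :: real by simp
  from this[OF *] show ?thesis unfolding eq .
qed

section \<open>Contractive multipliers and the corona estimate in the Hardy space\<close>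

abbreviation taylor :: "(complex \<Rightarrow> complex) \<Rightarrow> complex fps" where
  "taylor f \<equiv> fps_expansion f 0"

abbreviation hol :: "(complex \<Rightarrow> complex) \<Rightarrow> bool" where
  "hol f \<equiv> f holomorphic_on ball 0 1"

lemma taylor_has: "hol f \<Longrightarrow> f has_fps_expansion taylor f"
  by (rule has_fps_expansion_fps_expansion[of "ball 0 1"]) auto

lemma taylor_mult: "hol f \<Longrightarrow> hol g \<Longrightarrow> taylor (\<lambda>z. f z * g z) = taylor f * taylor g"
  by (intro fps_expansion_eqI has_fps_expansion_mult taylor_has)

lemma taylor_diff: "hol f \<Longrightarrow> hol g \<Longrightarrow> taylor (\<lambda>z. f z - g z) = taylor f - taylor g"
  by (intro fps_expansion_eqI has_fps_expansion_diff taylor_has)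

lemma taylor_cmult: "hol f \<Longrightarrow> taylor (\<lambda>z. c * f z) = fps_const c * taylor f"
  by (intro fps_expansion_eqI has_fps_expansion_cmult_left taylor_has)

lemma taylor_power: "taylor (\<lambda>z. z ^ n) = fps_X ^ n"
  by (intro fps_expansion_eqI has_fps_expansion_fps_X_power)

lemma taylor_sums: "hol f \<Longrightarrow> cmod z < 1 \<Longrightarrow> (\<lambda>n. taylor f $ n * z ^ n) sums f z"
  using holomorphic_power_series[of f 0 1 z] by (simp add: fps_expansion_def)

text \<open>Convergence at the larger radius \<open>(1 + r) / 2\<close> makes the series absolutely
  convergent at radius \<open>r\<close>, and the tail of absolute values there dominates all tails
  on the closed disc.\<close>

lemma taylor_uniform:
  assumes f: "hol f" and r: "0 < r" "r < 1" and e: "e > 0"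
  shows "\<exists>N0. \<forall>N\<ge>N0. \<forall>z. cmod z \<le> 1 \<longrightarrow>
     cmod ((\<Sum>n<N. taylor f $ n * of_real r ^ n * z ^ n) - f (of_real r * z)) \<le> e"
proof -
  have "summable (\<lambda>n. taylor f $ n * (of_real ((1 + r) / 2)) ^ n)"
    by (rule sums_summable[OF taylor_sums[OF f]]) (use r in \<open>simp only: norm_of_real, simp\<close>)
  then have sm: "summable (\<lambda>n. norm (taylor f $ n * of_real r ^ n))"
    by (rule powser_insidea) (use r in \<open>simp only: norm_of_real, simp\<close>)
  obtain N0 where N0: "\<And>N. N \<ge> N0 \<Longrightarrow> norm (\<Sum>i. norm (taylor f $ (i + N) * of_real r ^ (i + N))) < e"
    using suminf_exist_split[OF e sm] by blast
  show ?thesis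
  proof (intro exI[of _ N0] allI impI)
    fix N and z :: complex assume N: "N \<ge> N0" and z: "cmod z \<le> 1"
    let ?a = "\<lambda>n. taylor f $ n * of_real r ^ n * z ^ n"
    have rz: "cmod (of_real r * z) < 1"
    proof -
      have "cmod (of_real r * z) \<le> r * 1" using z r by (simp add: norm_mult)
      then show ?thesis using r by simp
    qed
    have "?a sums f (of_real r * z)"
      using taylor_sums[OF f rz] by (simp add: power_mult_distrib mult.assoc)
    then have fs: "f (of_real r * z) = (\<Sum>i. ?a (i + N)) + (\<Sum>n<N. ?a n)"
      using suminf_split_initial_segment[of ?a N] by (simp add: sums_iff)
    have le: "norm (?a n) \<le> norm (taylor f $ n * of_real r ^ n)" for n
      using power_le_one[OF norm_ge_zero z, of n] by (simp add: norm_mult norm_power mult_left_le)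
    have sm': "summable (\<lambda>i. norm (taylor f $ (i + N) * of_real r ^ (i + N)))"
      using sm by (rule summable_ignore_initial_segment)
    have "norm (\<Sum>i. ?a (i + N)) \<le> (\<Sum>i. norm (taylor f $ (i + N) * of_real r ^ (i + N)))"
      by (rule norm_suminf_le[OF le sm'])
    also have "\<dots> \<le> e" using N0[OF N] by simp
    finally show "cmod ((\<Sum>n<N. ?a n) - f (of_real r * z)) \<le> e"
      by (simp add: fs)
  qed
qed

text \<open>Dilation followed by truncation keeps the polynomials uniformly close to values of
  \<open>f\<close> inside the disc, so they inherit its upper and lower bounds up to a small error,
  while their coefficients still converge. The offset 2 keeps the radius positive at
  \<open>m = 0\<close>.\<close>

lemma poly_approx:
  assumes f: "hol f"
  shows "\<exists>P :: nat \<Rightarrow> complex poly. (\<forall>n. (\<lambda>m. coeff (P m) n) \<longlonglongrightarrow> taylor f $ n) \<and>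
    (\<forall>m z. cmod z \<le> 1 \<longrightarrow> cmod (poly (P m) z - f (of_real (1 - 1 / (of_nat m + 2)) * z)) \<le> 1 / of_nat (Suc m))"
proof -
  define r :: "nat \<Rightarrow> real" where "r m = 1 - 1 / (of_nat m + 2)" for m
  have r: "0 < r m" "r m < 1" for m by (auto simp: r_def field_simps)
  have rlim: "r \<longlonglongrightarrow> 1"
    unfolding r_def by real_asymp
  \<comment> \<open>Taking at least \<open>m\<close> terms ensures that each fixed coefficient is
    eventually present.\<close>
  have "\<exists>N\<ge>m. \<forall>z. cmod z \<le> 1 \<longrightarrow>
     cmod ((\<Sum>n<N. taylor f $ n * of_real (r m) ^ n * z ^ n) - f (of_real (r m) * z)) \<le> 1 / of_nat (Suc m)" for m
  proof -
    have "1 / real (Suc m) > 0" by simp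
    from taylor_uniform[OF f r(1)[of m] r(2)[of m] this] obtain N0 where
      "\<forall>N\<ge>N0. \<forall>z. cmod z \<le> 1 \<longrightarrow> cmod ((\<Sum>n<N. taylor f $ n * of_real (r m) ^ n * z ^ n) - f (of_real (r m) * z)) \<le> 1 / of_nat (Suc m)"
      by blast
    then show ?thesis by (intro exI[of _ "max m N0"]) simp
  qed
  then obtain N where N: "\<And>m. N m \<ge> m"
    "\<And>m z. cmod z \<le> 1 \<Longrightarrow> cmod ((\<Sum>n<N m. taylor f $ n * of_real (r m) ^ n * z ^ n) - f (of_real (r m) * z)) \<le> 1 / of_nat (Suc m)"
    by metis
  define P where "P m = (\<Sum>n<N m. monom (taylor f $ n * of_real (r m) ^ n) n)" for m
  have cP: "coeff (P m) n = (if n < N m then taylor f $ n * of_real (r m) ^ n else 0)" for m n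
    by (simp add: P_def coeff_sum)
  show ?thesis
  proof (intro exI[of _ P] conjI allI impI)
    fix n
    have "(\<lambda>m. taylor f $ n * of_real (r m) ^ n) \<longlonglongrightarrow> taylor f $ n * of_real 1 ^ n"
      by (intro tendsto_intros rlim)
    moreover have "\<forall>\<^sub>F m in sequentially. taylor f $ n * of_real (r m) ^ n = coeff (P m) n"
      using eventually_gt_at_top[of n] by eventually_elim (use N(1) in \<open>auto simp: cP dest: order_trans less_le_trans\<close>)
    ultimately show "(\<lambda>m. coeff (P m) n) \<longlonglongrightarrow> taylor f $ n"
      using tendsto_cong by fastforce
  next
    fix m and z :: complex assume z: "cmod z \<le> 1"
    have "poly (P m) z = (\<Sum>n<N m. taylor f $ n * of_real (r m) ^ n * z ^ n)"
      by (simp add: P_def poly_sum poly_monom)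
    then show "cmod (poly (P m) z - f (of_real (1 - 1 / (of_nat m + 2)) * z)) \<le> 1 / of_nat (Suc m)"
      using N(2)[OF z, of m] by (simp add: r_def)
  qed
qed

section \<open>Contractive multipliers and their adjoints\<close>

definition contractive :: "complex fps \<Rightarrow> bool" where
  "contractive F \<longleftrightarrow> (\<forall>G. l2 G \<longrightarrow> l2 (F * G) \<and> l2_sq (F * G) \<le> l2_sq G)"

lemma contractiveD: "contractive F \<Longrightarrow> l2 G \<Longrightarrow> l2 (F * G)" "contractive F \<Longrightarrow> l2 G \<Longrightarrow> l2_sq (F * G) \<le> l2_sq G"
  by (auto simp: contractive_def)

lemma l2_1: "l2 1"
  using l2_poly[of 1] by simp

lemma l2_X_power: "l2 (fps_X ^ n)"
  using l2_shift[OF l2_1, of n] by simp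

lemma contractive_l2: "contractive F \<Longrightarrow> l2 F"
  using contractiveD(1)[of F 1] l2_1 by simp

text \<open>The polynomial approximants are nearly contractive by their bound on the circle.
  Coefficients of a product below \<open>N\<close> depend only on those of the factors below
  \<open>N\<close>, so the bound passes to the limit for each truncation.\<close>

lemma contractive_hx:
  assumes f: "hol f" and le: "\<And>z. cmod z < 1 \<Longrightarrow> cmod (f z) \<le> 1"
  shows "contractive (taylor f)"
  unfolding contractive_def
proof (intro allI impI)
  fix G assume G: "l2 G"
  obtain P where P1: "\<And>n. (\<lambda>m. coeff (P m) n) \<longlonglongrightarrow> taylor f $ n"
    and P2: "\<And>m z. cmod z \<le> 1 \<Longrightarrow> cmod (poly (P m) z - f (of_real (1 - 1 / (of_nat m + 2)) * z)) \<le> 1 / of_nat (Suc m)"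
    using poly_approx[OF f] by blast
  have Pb: "cmod (poly (P m) z) \<le> 1 + 1 / of_nat (Suc m)" if z: "cmod z \<le> 1" for m z
  proof -
    define r :: real where "r = 1 - 1 / (of_nat m + 2)"
    have r: "0 < r" "r < 1" by (auto simp: r_def field_simps)
    have "cmod (of_real r * z) \<le> r * 1" using z r by (simp add: norm_mult)
    then have "cmod (f (of_real r * z)) \<le> 1" using r by (intro le) simp
    then show ?thesis
      using P2[OF z, of m, folded r_def] norm_triangle_sub[of "poly (P m) z" "f (of_real r * z)"] by linarith
  qed
  show "l2 (taylor f * G) \<and> l2_sq (taylor f * G) \<le> l2_sq G"
  proof (rule l2_of_bounded)
    fix N
    obtain g where g: "trunc N G = fps_of_poly g" using trunc_poly by blast
    have "l2_sq (trunc N (fps_of_poly (P m) * G)) \<le> (1 + 1 / of_nat (Suc m))\<^sup>2 * l2_sq G" for m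
    proof -
      have "trunc N (fps_of_poly (P m) * G) = trunc N (fps_of_poly (P m * g))"
        unfolding fps_of_poly_mult g[symmetric] by (auto intro!: fps_ext sum.cong simp: fps_mult_nth)
      also have "l2_sq \<dots> \<le> l2_sq (fps_of_poly (P m * g))" by (intro l2_sq_trunc_le l2_poly)
      also have "\<dots> \<le> (1 + 1 / of_nat (Suc m))\<^sup>2 * l2_sq (fps_of_poly g)"
        by (rule l2_sq_poly_mult_le) (use Pb in auto)
      also have "\<dots> \<le> (1 + 1 / of_nat (Suc m))\<^sup>2 * l2_sq G"
        unfolding g[symmetric] by (intro mult_left_mono l2_sq_trunc_le G) auto
      finally show ?thesis .
    qed
    moreover have "(\<lambda>m. l2_sq (trunc N (fps_of_poly (P m) * G))) \<longlonglongrightarrow> l2_sq (trunc N (taylor f * G))"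
      unfolding l2_sq_trunc fps_mult_nth by (intro tendsto_intros) (simp add: P1)
    moreover have "(\<lambda>m. (1 + 1 / of_nat (Suc m))\<^sup>2 * l2_sq G) \<longlonglongrightarrow> (1 + 0)\<^sup>2 * l2_sq G"
      by (intro tendsto_intros LIMSEQ_Suc[OF lim_1_over_n])
    ultimately show "l2_sq (trunc N (taylor f * G)) \<le> l2_sq G"
      using LIMSEQ_le by fastforce
  qed
qed

lemma trunc_Suc: "trunc (Suc N) F = trunc N F + fps_const (F $ N) * fps_X ^ N"
  by (rule fps_ext) (auto simp: fps_X_power_mult_right_nth less_Suc_eq)

text \<open>\<open>T\<close> is the coefficient series of the adjoint image of \<open>K\<close>.
  Pairing \<open>K\<close> with \<open>F\<close> times a truncation of \<open>T\<close> gives the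
  squared norm of that truncation; expanding the squared norm of their difference and using
  contractivity bounds it by that of \<open>K\<close>.\<close>

lemma contractive_adjoint_le:
  assumes F: "contractive F" and K: "l2 K"
  shows "(\<Sum>n<N. (cmod (l2_inner K (F * fps_X ^ n)))\<^sup>2) \<le> l2_sq K"
proof -
  define T where "T = Abs_fps (\<lambda>n. l2_inner K (F * fps_X ^ n))"
  have "l2_inner K (F * trunc N T) = of_real (l2_sq (trunc N T))"
  proof (induction N)
    case 0
    have "trunc 0 T = 0" by (rule fps_ext) auto
    then show ?case by (simp add: l2_inner_def l2_sq_def)
  next
    case (Suc N)
    have "F * trunc (Suc N) T = F * trunc N T + fps_const (T $ N) * (F * fps_X ^ N)"
      unfolding trunc_Suc by (simp add: algebra_simps)
    then have "l2_inner K (F * trunc (Suc N) T) = of_real (l2_sq (trunc N T)) + cnj (T $ N) * l2_inner K (F * fps_X ^ N)"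
      by (simp add: l2_inner_add_right l2_inner_cmult_right contractiveD[OF F] l2_trunc l2_X_power l2_cmult K Suc)
    also have "cnj (T $ N) * l2_inner K (F * fps_X ^ N) = of_real ((cmod (T $ N))\<^sup>2)"
      unfolding of_real_cmod_squared by (simp add: T_def)
    finally show ?case by (simp add: l2_sq_trunc)
  qed
  then have "0 \<le> l2_sq K + l2_sq (F * trunc N T) - 2 * l2_sq (trunc N T)"
    using l2_sq_diff[OF K contractiveD(1)[OF F l2_trunc], of N T] l2_sq_nonneg[OF l2_diff[OF K contractiveD(1)[OF F l2_trunc]], of N T]
    by simp
  then have "l2_sq (trunc N T) \<le> l2_sq K"
    using contractiveD(2)[OF F l2_trunc, of N T] by linarith
  then show ?thesis by (simp add: l2_sq_trunc T_def)
qed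

section \<open>The corona estimate for square-summable series\<close>

definition corona_C :: "real \<Rightarrow> real" where
  "corona_C \<delta> = 2 / (\<delta> / 2)\<^sup>2 + 16 * (corona_K (\<delta> / 2) 2 * (1 + 2 * 2\<^sup>2))\<^sup>2 * 2\<^sup>2"

lemma corona_C_pos: "\<delta> > 0 \<Longrightarrow> corona_C \<delta> > 0"
  unfolding corona_C_def by (intro add_pos_nonneg) auto

text \<open>\<open>corona_poly\<close> is applied to approximants of \<open>f1\<close> and
  \<open>f2\<close> with the polynomial \<open>trunc N K\<close> fixed. Only finitely many
  coefficients enter either side, so the estimate survives the limit.\<close>

lemma corona_trunc:
  assumes f: "hol f1" "hol f2"
    and le: "\<And>z. cmod z < 1 \<Longrightarrow> cmod (f1 z) \<le> 1" "\<And>z. cmod z < 1 \<Longrightarrow> cmod (f2 z) \<le> 1"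
    and ge: "\<And>z. cmod z < 1 \<Longrightarrow> \<delta> \<le> max (cmod (f1 z)) (cmod (f2 z))" and d: "\<delta> > 0"
  shows "l2_sq (trunc N K) \<le> corona_C \<delta> *
     ((\<Sum>n<N. (cmod (l2_inner (trunc N K) (taylor f1 * fps_X ^ n)))\<^sup>2) + (\<Sum>n<N. (cmod (l2_inner (trunc N K) (taylor f2 * fps_X ^ n)))\<^sup>2))"
proof -
  obtain k where k: "trunc N K = fps_of_poly k" using trunc_poly by blast
  obtain P where P1: "\<And>n. (\<lambda>m. coeff (P m) n) \<longlonglongrightarrow> taylor f1 $ n"
    and P2: "\<And>m z. cmod z \<le> 1 \<Longrightarrow> cmod (poly (P m) z - f1 (of_real (1 - 1 / (of_nat m + 2)) * z)) \<le> 1 / of_nat (Suc m)"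
    using poly_approx[OF f(1)] by blast
  obtain Q where Q1: "\<And>n. (\<lambda>m. coeff (Q m) n) \<longlonglongrightarrow> taylor f2 $ n"
    and Q2: "\<And>m z. cmod z \<le> 1 \<Longrightarrow> cmod (poly (Q m) z - f2 (of_real (1 - 1 / (of_nat m + 2)) * z)) \<le> 1 / of_nat (Suc m)"
    using poly_approx[OF f(2)] by blast
  \<comment> \<open>The adjoint image of \<open>trunc N K\<close> under multiplication by
    \<open>R\<close>. Its degree is below \<open>N\<close>, since the pairing with a shift by
    \<open>n \<ge> N\<close> vanishes.\<close>
  define p where "p R = (\<Sum>n<N. monom (l2_inner (trunc N K) (fps_of_poly R * fps_X ^ n)) n)" for R
  have p: "coeff (p R) n = l2_inner (fps_of_poly k) (fps_of_poly R * fps_X ^ n)" for R n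
    unfolding p_def k[symmetric] by (simp add: coeff_sum l2_inner_trunc_left fps_X_power_mult_right_nth)
  have sqp: "l2_sq (fps_of_poly (p R)) = (\<Sum>n<N. (cmod (l2_inner (trunc N K) (fps_of_poly R * fps_X ^ n)))\<^sup>2)" for R
  proof -
    have "trunc N (fps_of_poly (p R)) = fps_of_poly (p R)"
      by (rule fps_ext) (auto simp: p_def coeff_sum)
    then have "l2_sq (fps_of_poly (p R)) = l2_sq (trunc N (fps_of_poly (p R)))" by simp
    then show ?thesis unfolding l2_sq_trunc by (simp add: p k)
  qed
  \<comment> \<open>With approximation error at most 1 and at most \<open>\<delta> / 2\<close>, the
    approximants satisfy the upper bound 2 and the lower bound \<open>\<delta> / 2\<close> that are
    built into \<open>corona_C\<close>.\<close>
  have "l2_sq (trunc N K) \<le> corona_C \<delta> * (l2_sq (fps_of_poly (p (P m))) + l2_sq (fps_of_poly (p (Q m))))"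
    if m: "1 / of_nat (Suc m) \<le> \<delta> / 2" for m
    unfolding k corona_C_def
  proof (rule corona_poly)
    fix z :: complex assume z: "cmod z \<le> 1"
    define r :: real where "r = 1 - 1 / (of_nat m + 2)"
    have r: "0 < r" "r < 1" by (auto simp: r_def field_simps)
    have w: "cmod (of_real r * z) < 1"
    proof -
      have "cmod (of_real r * z) \<le> r * 1" using z r by (simp add: norm_mult)
      then show ?thesis using r by simp
    qed
    note PQ = P2[OF z, of m, folded r_def] Q2[OF z, of m, folded r_def]
    have m1: "1 / real (Suc m) \<le> 1" by simp
    show "cmod (poly (P m) z) \<le> 2" "cmod (poly (Q m) z) \<le> 2"
      using PQ le[OF w] norm_triangle_sub[of "poly (P m) z" "f1 (of_real r * z)"]
        norm_triangle_sub[of "poly (Q m) z" "f2 (of_real r * z)"] m1 by linarith+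
    have "\<delta> / 2 \<le> cmod (poly (P m) z) \<or> \<delta> / 2 \<le> cmod (poly (Q m) z)"
      using PQ ge[OF w] m norm_triangle_sub[of "f1 (of_real r * z)" "poly (P m) z"]
        norm_triangle_sub[of "f2 (of_real r * z)" "poly (Q m) z"]
      by (auto simp: norm_minus_commute max_def split: if_splits)
    then have "(\<delta> / 2)\<^sup>2 \<le> (cmod (poly (P m) z))\<^sup>2 \<or> (\<delta> / 2)\<^sup>2 \<le> (cmod (poly (Q m) z))\<^sup>2"
      using d by (metis half_gt_zero less_imp_le power_mono)
    then show "(\<delta> / 2)\<^sup>2 \<le> (cmod (poly (P m) z))\<^sup>2 + (cmod (poly (Q m) z))\<^sup>2"
      by (rule disjE) (simp_all add: add_increasing add_increasing2)
  qed (use d p in auto)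
  moreover have "\<forall>\<^sub>F m in sequentially. 1 / real (Suc m) \<le> \<delta> / 2"
    using order_tendstoD(2)[OF LIMSEQ_Suc[OF lim_1_over_n[where 'a = real]], of "\<delta> / 2"] d
    by (auto elim: eventually_mono)
  ultimately have ev: "\<forall>\<^sub>F m in sequentially. l2_sq (trunc N K) \<le> corona_C \<delta> * (l2_sq (fps_of_poly (p (P m))) + l2_sq (fps_of_poly (p (Q m))))"
    by (auto elim: eventually_mono)
  have ipl: "(\<lambda>m. l2_inner (trunc N K) (fps_of_poly (R m) * fps_X ^ n)) \<longlonglongrightarrow> l2_inner (trunc N K) (F * fps_X ^ n)"
    if "\<And>n. (\<lambda>m. coeff (R m) n) \<longlonglongrightarrow> F $ n" for R F n
    unfolding l2_inner_trunc_left fps_X_power_mult_right_nth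
    by (intro tendsto_intros) (use that in auto)
  show ?thesis
  proof (rule tendsto_lowerbound[OF _ ev])
    show "(\<lambda>m. corona_C \<delta> * (l2_sq (fps_of_poly (p (P m))) + l2_sq (fps_of_poly (p (Q m))))) \<longlonglongrightarrow> corona_C \<delta> *
     ((\<Sum>n<N. (cmod (l2_inner (trunc N K) (taylor f1 * fps_X ^ n)))\<^sup>2) + (\<Sum>n<N. (cmod (l2_inner (trunc N K) (taylor f2 * fps_X ^ n)))\<^sup>2))"
      unfolding sqp by (intro tendsto_intros ipl P1 Q1)
  qed simp
qed

text \<open>The estimate is applied to \<open>trunc N K\<close>. Exchanging \<open>K\<close> for its
  truncation in the pairings costs at most the norm of the tail, by
  \<open>contractive_adjoint_le\<close>, and the tail tends to zero. The factor 2 comes from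
  \<open>cmod_add_sq_le\<close>; by \<open>Z\<close> only the pairings with \<open>f1\<close>
  remain.\<close>

lemma corona_hardy:
  assumes f: "hol f1" "hol f2"
    and le: "\<And>z. cmod z < 1 \<Longrightarrow> cmod (f1 z) \<le> 1" "\<And>z. cmod z < 1 \<Longrightarrow> cmod (f2 z) \<le> 1"
    and ge: "\<And>z. cmod z < 1 \<Longrightarrow> \<delta> \<le> max (cmod (f1 z)) (cmod (f2 z))" and d: "\<delta> > 0"
    and K: "l2 K" and A: "\<And>N. (\<Sum>n<N. (cmod (l2_inner K (taylor f1 * fps_X ^ n)))\<^sup>2) \<le> A"
    and Z: "\<And>n. l2_inner K (taylor f2 * fps_X ^ n) = 0"
  shows "l2_sq K \<le> 2 * corona_C \<delta> * A"
proof -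
  have c1: "contractive (taylor f1)" and c2: "contractive (taylor f2)" using f le by (auto intro: contractive_hx)
  have *: "(\<Sum>n<N. (cmod (l2_inner (trunc N K) (F * fps_X ^ n)))\<^sup>2)
      \<le> 2 * (\<Sum>n<N. (cmod (l2_inner K (F * fps_X ^ n)))\<^sup>2) + 2 * l2_sq (K - trunc N K)" if F: "contractive F" for F N
  proof -
    have "(\<Sum>n<N. (cmod (l2_inner (trunc N K) (F * fps_X ^ n)))\<^sup>2)
      \<le> (\<Sum>n<N. 2 * (cmod (l2_inner K (F * fps_X ^ n)))\<^sup>2 + 2 * (cmod (l2_inner (K - trunc N K) (F * fps_X ^ n)))\<^sup>2)"
    proof (rule sum_mono)
      fix n
      have "l2_inner (trunc N K) (F * fps_X ^ n) = l2_inner K (F * fps_X ^ n) + - l2_inner (K - trunc N K) (F * fps_X ^ n)"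
        by (simp add: l2_inner_diff_left K l2_trunc contractiveD[OF F l2_X_power])
      then show "(cmod (l2_inner (trunc N K) (F * fps_X ^ n)))\<^sup>2 \<le> 2 * (cmod (l2_inner K (F * fps_X ^ n)))\<^sup>2 + 2 * (cmod (l2_inner (K - trunc N K) (F * fps_X ^ n)))\<^sup>2"
        using cmod_add_sq_le[of "l2_inner K (F * fps_X ^ n)" "- l2_inner (K - trunc N K) (F * fps_X ^ n)"] by simp
    qed
    also have "\<dots> \<le> 2 * (\<Sum>n<N. (cmod (l2_inner K (F * fps_X ^ n)))\<^sup>2) + 2 * l2_sq (K - trunc N K)"
      using contractive_adjoint_le[OF F l2_diff[OF K l2_trunc[of N K]], where N = N] by (simp add: sum.distrib flip: sum_distrib_left)
    finally show ?thesis .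
  qed
  have "l2_sq (trunc N K) \<le> corona_C \<delta> * (2 * A + 4 * l2_sq (K - trunc N K))" for N
  proof -
    have "l2_sq (trunc N K) \<le> corona_C \<delta> *
     ((\<Sum>n<N. (cmod (l2_inner (trunc N K) (taylor f1 * fps_X ^ n)))\<^sup>2) + (\<Sum>n<N. (cmod (l2_inner (trunc N K) (taylor f2 * fps_X ^ n)))\<^sup>2))"
      by (rule corona_trunc[OF f le ge d])
    also have "\<dots> \<le> corona_C \<delta> * (2 * A + 4 * l2_sq (K - trunc N K))"
      using *[OF c1, of N] *[OF c2, of N] A[of N] corona_C_pos[OF d] by (intro mult_left_mono) (auto simp: Z)
    finally show ?thesis .
  qed
  moreover have "(\<lambda>N. corona_C \<delta> * (2 * A + 4 * l2_sq (K - trunc N K))) \<longlonglongrightarrow> corona_C \<delta> * (2 * A + 4 * 0)"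
    by (intro tendsto_intros l2_sq_tail_lim K)
  ultimately show ?thesis
    using LIMSEQ_le[OF l2_sq_trunc_lim[OF K]] by (simp add: mult_ac)
qed

section \<open>Blaschke products are inner\<close>

lemma eventually_in_disc: "\<forall>\<^sub>F z in nhds (0::complex). z \<in> ball 0 1"
  by (rule eventually_nhds_in_open) auto

text \<open>The form \<open>\<langle>x, y\<rangle> - \<langle>F x, F y\<rangle>\<close> is positive semidefinite, so a null vector of its quadratic form lies in its
  kernel.\<close>

lemma contractive_cross:
  assumes F: "contractive F" and e: "l2 e" and y: "l2 y" and eq: "l2_sq (F * e) = l2_sq e"
  shows "l2_inner (F * e) (F * y) = l2_inner e y"
proof -
  define d where "d = l2_inner e y - l2_inner (F * e) (F * y)"
  define D where "D = l2_sq y - l2_sq (F * y)"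
  have D0: "D \<ge> 0" using contractiveD(2)[OF F y] by (simp add: D_def)
  \<comment> \<open>Adding \<open>c * y\<close> to \<open>e\<close> changes the form by
    \<open>- 2 * t\<close> times the squared modulus of \<open>d\<close> to first order;
    \<open>t * D < 1\<close> keeps the quadratic term smaller, which forces
    \<open>d = 0\<close>.\<close>
  define t where "t = 1 / (D + 1)"
  have t0: "t > 0" "t * D < 1" using D0 by (auto simp: t_def)
  define c where "c = - of_real t * d"
  have "F * (e + fps_const c * y) = F * e + fps_const c * (F * y)"
    by (simp add: algebra_simps)
  then have "l2_sq (F * e + fps_const c * (F * y)) \<le> l2_sq (e + fps_const c * y)"
    using contractiveD(2)[OF F l2_add[OF e l2_cmult[OF y]]] by metis
  then have "(cmod c)\<^sup>2 * l2_sq (F * y) + 2 * Re (cnj c * l2_inner (F * e) (F * y)) \<le> (cmod c)\<^sup>2 * l2_sq y + 2 * Re (cnj c * l2_inner e y)"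
    by (simp add: l2_sq_add l2_sq_cmult l2_inner_cmult_right l2_cmult e y contractiveD(1)[OF F] eq)
  then have "0 \<le> (cmod c)\<^sup>2 * D + 2 * Re (cnj c * d)"
    by (simp add: D_def d_def algebra_simps)
  also have "cnj c * d = of_real (- t * (cmod d)\<^sup>2)"
    unfolding of_real_mult of_real_cmod_squared by (simp add: c_def mult_ac)
  also have "(cmod c)\<^sup>2 * D + 2 * Re (of_real (- t * (cmod d)\<^sup>2)) = t * (cmod d)\<^sup>2 * (t * D - 2)"
    by (simp add: c_def norm_mult power_mult_distrib algebra_simps power2_eq_square)
  finally have "0 \<le> t * (cmod d)\<^sup>2 * (t * D - 2)" .
  then have "t * (cmod d)\<^sup>2 \<le> 0" using t0 by (simp add: zero_le_mult_iff)
  then have "d = 0" using t0 by (simp add: mult_le_0_iff)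
  then show ?thesis by (simp add: d_def)
qed

lemma l2_sq_const: "l2_sq (fps_const c) = (cmod c)\<^sup>2"
  unfolding l2_sq_def by (subst suminf_finite[of "{0}"]) auto

lemma l2_sq_shift: "l2 F \<Longrightarrow> l2_sq (F * fps_X ^ m) = l2_sq F"
  using suminf_split_initial_segment[OF l2_shift[unfolded l2_def], of F m m]
  unfolding l2_sq_def l2_def by (simp add: fps_X_power_mult_right_nth)

text \<open>An \<open>F\<close> of norm 1 is isometric on monomials, since shifts preserve norms. By
  \<open>contractive_cross\<close>, equality of norms at a vector also preserves its inner products,
  so isometry extends to finite sums and then, the image of the tail adding a nonnegative amount, to
  all square-summable series.\<close>

lemma contractive_isometry:
  assumes F: "contractive F" and 1: "l2_sq F = 1" and G: "l2 G"
  shows "l2_sq (F * G) = l2_sq G"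
proof -
  have tr: "l2_sq (F * trunc N G) = l2_sq (trunc N G)" for N
  proof (induction N)
    case 0
    have "trunc 0 G = 0" by (rule fps_ext) auto
    then show ?case by simp
  next
    case (Suc N)
    let ?y = "fps_const (G $ N) * fps_X ^ N"
    have y: "l2 ?y" by (intro l2_cmult l2_X_power)
    have "l2_sq (F * ?y) = (cmod (G $ N))\<^sup>2"
      using l2_sq_cmult[OF l2_shift[OF contractive_l2[OF F]], of "G $ N" N] l2_sq_shift[OF contractive_l2[OF F], of N] 1
      by (simp add: mult.left_commute)
    moreover have "l2_sq ?y = (cmod (G $ N))\<^sup>2"
      using l2_sq_cmult[OF l2_X_power, of "G $ N" N] l2_sq_shift[OF l2_1, of N] l2_sq_const[of 1] by simp
    ultimately show ?case
      unfolding trunc_Suc distrib_left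
      by (simp add: l2_sq_add contractiveD(1)[OF F] l2_trunc y Suc contractive_cross[OF F l2_trunc y Suc])
  qed
  have "l2_sq (trunc N G) \<le> l2_sq (F * G)" for N
  proof -
    have y: "l2 (G - trunc N G)" by (intro l2_diff G l2_trunc)
    have "F * G = F * trunc N G + F * (G - trunc N G)" by (simp add: algebra_simps)
    then have "l2_sq (F * G) = l2_sq (trunc N G) + l2_sq (F * (G - trunc N G)) + 2 * Re (l2_inner (trunc N G) (G - trunc N G))"
      by (simp only: l2_sq_add contractiveD(1)[OF F] l2_trunc y tr contractive_cross[OF F l2_trunc y tr])
    also have "l2_inner (trunc N G) (G - trunc N G) = 0"
      by (simp add: l2_inner_trunc_left)
    finally show ?thesis using l2_sq_nonneg[OF contractiveD(1)[OF F y]] by simp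
  qed
  then have "l2_sq G \<le> l2_sq (F * G)"
    by (intro LIMSEQ_le_const2[OF l2_sq_trunc_lim[OF G]]) auto
  then show ?thesis using contractiveD(2)[OF F G] by simp
qed

text \<open>An encoding without boundary values: for a function bounded by 1, norm 1 means modulus 1
  almost everywhere on the circle.\<close>

definition inner_function :: "(complex \<Rightarrow> complex) \<Rightarrow> bool" where
  "inner_function f \<longleftrightarrow> hol f \<and> (\<forall>z. cmod z < 1 \<longrightarrow> cmod (f z) \<le> 1) \<and> l2_sq (taylor f) = 1"

lemma inner_function_contractive: "inner_function f \<Longrightarrow> contractive (taylor f)"
  unfolding inner_function_def by (auto intro: contractive_hx)

lemma inner_function_l2_sq: "inner_function f \<Longrightarrow> l2 G \<Longrightarrow> l2_sq (taylor f * G) = l2_sq G"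
  using contractive_isometry inner_function_contractive inner_function_def by blast

lemma inner_function_l2_inner: "inner_function f \<Longrightarrow> l2 G \<Longrightarrow> l2 H \<Longrightarrow> l2_inner (taylor f * G) (taylor f * H) = l2_inner G H"
  by (intro contractive_cross inner_function_contractive inner_function_l2_sq)

lemma inner_function_mult: assumes "inner_function f" "inner_function g" shows "inner_function (\<lambda>z. f z * g z)"
proof -
  have "l2_sq (taylor (\<lambda>z. f z * g z)) = l2_sq (taylor f * taylor g)"
    using assms by (simp add: inner_function_def taylor_mult)
  also have "\<dots> = 1"
    using assms inner_function_l2_sq[OF assms(1) contractive_l2[OF inner_function_contractive[OF assms(2)]]] by (simp add: inner_function_def)
  finally show ?thesis
    using assms unfolding inner_function_def by (auto intro!: holomorphic_intros simp: norm_mult mult_le_one)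
qed

lemma taylor_const: "taylor (\<lambda>z. c) = fps_const c"
  by (intro fps_expansion_eqI has_fps_expansion_const)

lemma inner_function_const: "cmod c = 1 \<Longrightarrow> inner_function (\<lambda>z. c)"
  by (simp add: inner_function_def taylor_const l2_sq_const)

lemma inner_function_cong:
  assumes "inner_function f" "\<And>z. z \<in> ball 0 1 \<Longrightarrow> g z = f z"
  shows "inner_function g"
proof -
  have "\<forall>\<^sub>F w in nhds 0. g w = f w"
    using assms(2) eventually_in_disc by (auto elim!: eventually_mono)
  then have "taylor g = taylor f" by (rule fps_expansion_cong)
  moreover have "hol g" using assms holomorphic_cong[of "ball 0 1" _ g f] by (simp add: inner_function_def)
  ultimately show ?thesis using assms by (auto simp: inner_function_def)
qed

section \<open>Blaschke factors\<close>

lemma blaschke_denominator_nonzero: "cmod a < 1 \<Longrightarrow> cmod z < 1 \<Longrightarrow> 1 - cnj a * z \<noteq> 0"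
proof
  assume a: "cmod a < 1" "cmod z < 1" "1 - cnj a * z = 0"
  then have "cmod (cnj a * z) = 1" by (metis norm_one right_minus_eq)
  moreover have "cmod (cnj a * z) \<le> 1 * cmod z"
    unfolding norm_mult using a by (intro mult_right_mono) auto
  ultimately show False using a by simp
qed

text \<open>\<open>C\<close> is the expansion obtained from the geometric series. It is identified
  by multiplying with the denominator, which cancels because its constant coefficient is 1. With
  \<open>A\<close> the squared modulus of \<open>a\<close>, the squared coefficients sum to
  \<open>A + (1 - A)\<close>.\<close>

lemma l2_sq_moebius:
  assumes a: "cmod a < 1"
  shows "hol (\<lambda>z. (a - z) / (1 - cnj a * z))" "l2_sq (taylor (\<lambda>z. (a - z) / (1 - cnj a * z))) = 1"
proof -
  let ?f = "\<lambda>z. (a - z) / (1 - cnj a * z)"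
  define C where "C = Abs_fps (\<lambda>n. if n = 0 then a else - of_real (1 - (cmod a)\<^sup>2) * cnj a ^ (n - 1))"
  show f: "hol ?f" by (intro holomorphic_intros) (use blaschke_denominator_nonzero[OF a] in auto)
  have "taylor (\<lambda>z. ?f z * (1 - cnj a * z)) = taylor ?f * taylor (\<lambda>z. 1 - cnj a * z)"
    by (intro taylor_mult f holomorphic_intros)
  moreover have "taylor (\<lambda>z. ?f z * (1 - cnj a * z)) = taylor (\<lambda>z. a - z)"
  proof (rule fps_expansion_cong)
    show "\<forall>\<^sub>F z in nhds 0. ?f z * (1 - cnj a * z) = a - z"
      using eventually_in_disc by (rule eventually_mono) (use blaschke_denominator_nonzero[OF a] in auto)
  qed
  moreover have "taylor (\<lambda>z. a - z) = fps_const a - fps_X"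
    by (intro fps_expansion_eqI fps_expansion_intros)
  moreover have "taylor (\<lambda>z. 1 - cnj a * z) = 1 - fps_const (cnj a) * fps_X"
    by (intro fps_expansion_eqI fps_expansion_intros)
  moreover have "C * (1 - fps_const (cnj a) * fps_X) = fps_const a - fps_X"
  proof (rule fps_ext)
    fix n
    have m: "(C * (1 - fps_const (cnj a) * fps_X)) $ n = C $ n - cnj a * (if n = 0 then 0 else C $ (n - 1))"
    proof -
      have "C * (1 - fps_const (cnj a) * fps_X) = C - fps_const (cnj a) * (C * fps_X)"
        by (simp add: algebra_simps)
      then show ?thesis by (simp only: fps_sub_nth fps_mult_left_const_nth fps_X_mult_right_nth)
    qed
    have aa: "a * cnj a = of_real ((cmod a)\<^sup>2)" unfolding of_real_cmod_squared ..
    show "(C * (1 - fps_const (cnj a) * fps_X)) $ n = (fps_const a - fps_X) $ n"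
      unfolding m unfolding C_def using aa
      by (cases n; cases "n - 1") (auto simp: algebra_simps)
  qed
  ultimately have "taylor ?f * (1 - fps_const (cnj a) * fps_X) = C * (1 - fps_const (cnj a) * fps_X)" by simp
  moreover have "(1 - fps_const (cnj a) * fps_X) \<noteq> 0"
  proof
    assume "(1 - fps_const (cnj a) * fps_X) = 0"
    then have "(1 - fps_const (cnj a) * fps_X) $ 0 = 0" by simp
    then show False by simp
  qed
  ultimately have "taylor ?f = C" by simp
  moreover have "(\<lambda>n. (cmod (C $ n))\<^sup>2) sums 1"
  proof -
    define A where "A = (cmod a)\<^sup>2"
    have A: "0 \<le> A" "A < 1" using a by (auto simp: A_def power_less_one_iff)
    have "(\<lambda>n. (1 - A)\<^sup>2 * A ^ n) sums ((1 - A)\<^sup>2 * (1 / (1 - A)))"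
      using A by (intro sums_mult geometric_sums) auto
    moreover have "(1 - A)\<^sup>2 * A ^ n = (cmod (C $ Suc n))\<^sup>2" for n
    proof -
      have "C $ Suc n = - (of_real (1 - A) * cnj a ^ n)"
        by (simp add: C_def A_def algebra_simps)
      then have "cmod (C $ Suc n) = \<bar>1 - A\<bar> * cmod a ^ n"
        by (simp only: norm_minus_cancel norm_mult norm_of_real norm_power complex_mod_cnj)
      moreover have "(cmod a ^ n)\<^sup>2 = A ^ n"
        unfolding A_def by (simp only: power_mult[symmetric] mult.commute)
      ultimately show ?thesis by (simp add: power_mult_distrib)
    qed
    ultimately have "(\<lambda>n. (cmod (C $ Suc n))\<^sup>2) sums (1 - A)"
      using A by (simp add: power2_eq_square)
    then show ?thesis
      by (subst (asm) sums_Suc_iff) (simp add: C_def A_def)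
  qed
  ultimately show "l2_sq (taylor ?f) = 1" by (simp add: l2_sq_def sums_iff)
qed

lemma inner_function_blaschke_factor:
  assumes a: "cmod a < 1" shows "inner_function (blaschke_factor a)"
proof (cases "a = 0")
  case True
  have "inner_function (\<lambda>z. z)"
    using taylor_power[of 1] l2_sq_shift[OF l2_1, of 1] l2_sq_const[of 1] by (simp add: inner_function_def less_imp_le)
  then show ?thesis by (rule inner_function_cong) (simp add: True blaschke_factor_def)
next
  case False
  have "inner_function (\<lambda>z. (a - z) / (1 - cnj a * z))"
    unfolding inner_function_def
  proof (intro conjI allI impI l2_sq_moebius a)
    fix z assume "cmod z < 1"
    from Moebius_function_norm_lt_1[OF a this, of 0]
    show "cmod ((a - z) / (1 - cnj a * z)) \<le> 1"
      by (simp add: Moebius_function_def norm_divide norm_minus_commute)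
  qed
  moreover have "inner_function (\<lambda>z. of_real (cmod a) / a)"
    by (rule inner_function_const) (use False in \<open>simp add: norm_divide\<close>)
  ultimately have "inner_function (\<lambda>z. of_real (cmod a) / a * ((a - z) / (1 - cnj a * z)))"
    by (intro inner_function_mult)
  then show ?thesis by (rule inner_function_cong) (simp add: False blaschke_factor_def)
qed

section \<open>Infinite products of inner functions\<close>

lemma blaschke_factor_0: "blaschke_factor a 0 = of_real (cmod a)"
  by (simp add: blaschke_factor_def)

text \<open>Factoring \<open>1 - cmod a\<close> out of \<open>1 - blaschke_factor a z\<close> turns
  the Blaschke condition into a summable majorant, uniform for \<open>z\<close> away from the
  circle.\<close>

lemma blaschke_factor_near_1:
  assumes a: "cmod a < 1" and z: "cmod z < 1"
  shows "cmod (blaschke_factor a z - 1) \<le> (1 - cmod a) * (2 / (1 - cmod z))"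
proof (cases "a = 0")
  case True
  have "cmod (z - 1) \<le> 2" using z norm_triangle_ineq4[of z 1] by simp
  also have "2 \<le> 2 / (1 - cmod z)" using z by (simp add: field_simps)
  finally show ?thesis by (simp add: True blaschke_factor_def)
next
  case False
  have nz: "1 - cnj a * z \<noteq> 0" by (rule blaschke_denominator_nonzero[OF a z])
  have aa: "cnj a * a = of_real (cmod a) * of_real (cmod a)"
    using of_real_cmod_squared[of a] by (simp add: power2_eq_square mult.commute)
  have "1 - blaschke_factor a z = of_real (1 - cmod a) * (a + of_real (cmod a) * z) / (a * (1 - cnj a * z))"
  proof -
    have "(1 - blaschke_factor a z) * (a * (1 - cnj a * z)) = a - (cnj a * a) * z - of_real (cmod a) * (a - z)"
      using False nz by (simp add: blaschke_factor_def left_diff_distrib) (simp add: algebra_simps)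
    also have "\<dots> = of_real (1 - cmod a) * (a + of_real (cmod a) * z)"
      unfolding aa by (simp add: algebra_simps)
    finally show ?thesis using False nz by (simp add: eq_divide_eq)
  qed
  then have "cmod (blaschke_factor a z - 1) = (1 - cmod a) * cmod (a + of_real (cmod a) * z) / (cmod a * cmod (1 - cnj a * z))"
    using a by (subst norm_minus_commute) (simp add: norm_divide norm_mult del: of_real_diff)
  also have "\<dots> \<le> (1 - cmod a) * (cmod a * 2) / (cmod a * (1 - cmod z))"
  proof (intro frac_le mult_left_mono mult_nonneg_nonneg)
    have "cmod (a + of_real (cmod a) * z) \<le> cmod a + cmod a * cmod z"
      using norm_triangle_ineq[of a "of_real (cmod a) * z"] by (simp add: norm_mult)
    also have "\<dots> \<le> cmod a * 2" using z mult_left_mono[of "cmod z" 1 "cmod a"] by simp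
    finally show "cmod (a + of_real (cmod a) * z) \<le> cmod a * 2" .
    have "cmod (cnj a * z) \<le> 1 * cmod z"
      unfolding norm_mult using a by (intro mult_right_mono) auto
    then show "1 - cmod z \<le> cmod (1 - cnj a * z)"
      using norm_triangle_ineq2[of 1 "cnj a * z"] by simp
  qed (use a z False in auto)
  also have "\<dots> = (1 - cmod a) * (2 / (1 - cmod z))" using False by simp
  finally show ?thesis .
qed

text \<open>Weierstrass's product inequality: in the inductive step the new term is multiplied by a
  partial product of at most 1.\<close>

lemma prod_one_minus_ge:
  fixes y :: "nat \<Rightarrow> real"
  assumes "\<And>n. 0 \<le> y n" "\<And>n. y n \<le> 1"
  shows "1 - (\<Sum>n<N. y n) \<le> (\<Prod>n<N. 1 - y n)"
proof (induction N)
  case (Suc N)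
  have "(\<Prod>n<N. 1 - y n) \<le> 1" using assms by (intro prod_le_1) auto
  then have "(\<Prod>n<N. 1 - y n) * y N \<le> y N" using assms(1)[of N] mult_right_mono by fastforce
  then show ?case using Suc by (simp add: algebra_simps)
qed simp

text \<open>Splitting off a partial product, which is an isometric multiplier, leaves a tail whose value at \<open>0\<close>
  is close to \<open>1\<close>; hence the product has norm \<open>1\<close>.\<close>

lemma inner_function_prodinf:
  fixes e :: "nat \<Rightarrow> complex \<Rightarrow> complex" and x :: "nat \<Rightarrow> real"
  assumes e: "\<And>n. inner_function (e n)" and x: "\<And>n. 0 \<le> x n" "\<And>n. x n \<le> 1" "summable x"
    and le: "\<And>n z. cmod z < 1 \<Longrightarrow> cmod (e n z - 1) \<le> x n * (2 / (1 - cmod z))"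
    and e0: "\<And>n. e n 0 = of_real (1 - x n)"
  shows "inner_function (\<lambda>z. \<Prod>n. e n z)"
proof -
  \<comment> \<open>The shift \<open>k\<close> lets the same facts serve for the full product, at
    \<open>k = 0\<close>, and for its tails.\<close>
  have lim: "(\<lambda>N. \<Prod>n<N. e (n + k) z) \<longlonglongrightarrow> (\<Prod>n. e (n + k) z)" if z: "cmod z < 1" for z k
  proof -
    have "summable (\<lambda>n. norm (e (n + k) z - 1))"
    proof (rule summable_comparison_test'[where N = 0])
      show "summable (\<lambda>n. x (n + k) * (2 / (1 - cmod z)))"
        by (intro summable_mult2 summable_ignore_initial_segment x)
    qed (use le[OF z] in auto)
    then have "convergent_prod (\<lambda>n. e (n + k) z)"
      by (intro abs_convergent_prod_imp_convergent_prod summable_imp_abs_convergent_prod)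
    then show ?thesis
      using convergent_prod_LIMSEQ LIMSEQ_lessThan_iff_atMost by blast
  qed
  have ie: "inner_function (\<lambda>z. \<Prod>n<N. e (n + k) z)" for N k
  proof (induction N)
    case 0 then show ?case by (simp add: inner_function_const)
  next
    case (Suc N) then show ?case using inner_function_mult[OF Suc e[of "N + k"]] by simp
  qed
  have hol: "hol (\<lambda>z. \<Prod>n. e (n + k) z)" for k
  proof (rule holomorphic_uniform_sequence[where f = "\<lambda>N z. \<Prod>n<N. e (n + k) z"])
    show "hol (\<lambda>z. \<Prod>n<N. e (n + k) z)" for N using ie by (simp add: inner_function_def)
    fix w :: complex assume w: "w \<in> ball 0 1"
    \<comment> \<open>Half the distance to the circle, so that \<open>1 - cmod z \<ge> d\<close> on
      the small disc and the majorants no longer depend on \<open>z\<close>.\<close>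
    define d where "d = (1 - cmod w) / 2"
    have d: "d > 0" using w by (simp add: d_def)
    have zb: "cmod z \<le> 1 - d" if "z \<in> cball w d" for z
      using that norm_triangle_sub[of z w] by (auto simp: d_def dist_norm norm_minus_commute field_simps)
    have sub: "cball w d \<subseteq> ball 0 1" using zb d by fastforce
    have "uniformly_convergent_on (cball w d) (\<lambda>N z. \<Prod>n<N. e (n + k) z)"
    proof (rule uniformly_convergent_on_prod')
      show "continuous_on (cball w d) (e (n + k))" for n
        using e[of "n + k"] sub unfolding inner_function_def by (meson continuous_on_subset holomorphic_on_imp_continuous_on)
      show "uniformly_convergent_on (cball w d) (\<lambda>N z. \<Sum>n<N. norm (e (n + k) z - 1))"
      proof (rule Weierstrass_m_test')
        show "summable (\<lambda>n. x (n + k) * (2 / d))"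
          by (intro summable_mult2 summable_ignore_initial_segment x)
        fix n z assume z: "z \<in> cball w d"
        have "norm (e (n + k) z - 1) \<le> x (n + k) * (2 / (1 - cmod z))"
          by (rule le) (use zb[OF z] d in auto)
        also have "\<dots> \<le> x (n + k) * (2 / d)"
          by (intro mult_left_mono x divide_left_mono) (use zb[OF z] d in auto)
        finally show "norm (norm (e (n + k) z - 1)) \<le> x (n + k) * (2 / d)" by simp
      qed
    qed auto
    then obtain l where l: "uniform_limit (cball w d) (\<lambda>N z. \<Prod>n<N. e (n + k) z) l sequentially"
      by (auto simp: uniformly_convergent_on_def)
    have "l z = (\<Prod>n. e (n + k) z)" if "z \<in> cball w d" for z
      using LIMSEQ_unique[OF tendsto_uniform_limitI[OF l that] lim[of z k]] sub that by auto
    then have "uniform_limit (cball w d) (\<lambda>N z. \<Prod>n<N. e (n + k) z) (\<lambda>z. \<Prod>n. e (n + k) z) sequentially"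
      using l uniform_limit_cong' by (metis (no_types, lifting))
    then show "\<exists>d>0. cball w d \<subseteq> ball 0 1 \<and> uniform_limit (cball w d) (\<lambda>N z. \<Prod>n<N. e (n + k) z) (\<lambda>z. \<Prod>n. e (n + k) z) sequentially"
      using d sub by blast
  qed auto
  have le1: "cmod (\<Prod>n. e (n + k) z) \<le> 1" if z: "cmod z < 1" for z k
  proof (rule LIMSEQ_le_const2[OF tendsto_norm[OF lim[OF z]]])
    show "\<exists>M. \<forall>N\<ge>M. cmod (\<Prod>n<N. e (n + k) z) \<le> 1"
      using ie z by (auto simp: inner_function_def)
  qed
  have ct: "contractive (taylor (\<lambda>z. \<Prod>n. e (n + k) z))" for k
    by (intro contractive_hx hol le1)
  have ge: "l2_sq (taylor (\<lambda>z. \<Prod>n. e n z)) \<ge> (1 - (\<Sum>n. x (n + N)))\<^sup>2" if N: "(\<Sum>n. x (n + N)) < 1" for N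
  proof -
    let ?T = "\<lambda>z. \<Prod>n. e (n + N) z" and ?Q = "\<lambda>z. \<Prod>n<N. e n z"
    have iQ: "inner_function ?Q" using ie[where N = N and k = 0] by simp
    have split: "(\<Prod>n. e n z) = ?Q z * ?T z" if z: "z \<in> ball 0 1" for z
    proof (rule LIMSEQ_unique)
      have "(\<lambda>M. \<Prod>n<M. e n z) \<longlonglongrightarrow> (\<Prod>n. e n z)" using lim[of z 0] z by simp
      then show "(\<lambda>M. \<Prod>n<M + N. e n z) \<longlonglongrightarrow> (\<Prod>n. e n z)" by (rule LIMSEQ_ignore_initial_segment)
      have "(\<Prod>n<M + N. e n z) = ?Q z * (\<Prod>n<M. e (n + N) z)" for M
        by (induction M) (auto simp: mult_ac)
      then show "(\<lambda>M. \<Prod>n<M + N. e n z) \<longlonglongrightarrow> ?Q z * ?T z"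
        using lim[of z N] z by (auto intro!: tendsto_intros)
    qed
    have "\<forall>\<^sub>F z in nhds 0. (\<Prod>n. e n z) = ?Q z * ?T z"
      using eventually_in_disc by (rule eventually_mono) (use split in auto)
    then have "taylor (\<lambda>z. \<Prod>n. e n z) = taylor (\<lambda>z. ?Q z * ?T z)" by (rule fps_expansion_cong)
    also have "\<dots> = taylor ?Q * taylor ?T" using iQ hol by (intro taylor_mult) (auto simp: inner_function_def)
    finally have "l2_sq (taylor (\<lambda>z. \<Prod>n. e n z)) = l2_sq (taylor ?T)"
      using inner_function_l2_sq[OF iQ contractive_l2[OF ct]] by simp
    also have "\<dots> \<ge> l2_sq (trunc 1 (taylor ?T))" by (intro l2_sq_trunc_le contractive_l2 ct)
    also have "l2_sq (trunc 1 (taylor ?T)) = (cmod (?T 0))\<^sup>2"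
      by (simp add: l2_sq_trunc fps_expansion_def)
    finally have 1: "(cmod (?T 0))\<^sup>2 \<le> l2_sq (taylor (\<lambda>z. \<Prod>n. e n z))" .
    have "1 - (\<Sum>n. x (n + N)) \<le> cmod (?T 0)"
    proof (rule LIMSEQ_le_const[OF tendsto_norm[OF lim]])
      have "1 - (\<Sum>n. x (n + N)) \<le> cmod (\<Prod>n<M. e (n + N) 0)" for M
      proof -
        have "(\<Sum>n<M. x (n + N)) \<le> (\<Sum>n. x (n + N))"
          by (intro sum_le_suminf summable_ignore_initial_segment x) (auto simp: x)
        then have "1 - (\<Sum>n. x (n + N)) \<le> 1 - (\<Sum>n<M. x (n + N))" by simp
        also have "\<dots> \<le> (\<Prod>n<M. 1 - x (n + N))" by (rule prod_one_minus_ge) (use x in auto)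
        also have "\<dots> \<le> \<bar>\<Prod>n<M. 1 - x (n + N)\<bar>" by simp
        also have "\<dots> = cmod (\<Prod>n<M. e (n + N) 0)"
          unfolding e0 of_real_prod[symmetric] norm_of_real ..
        finally show ?thesis .
      qed
      then show "\<exists>M0. \<forall>M\<ge>M0. 1 - (\<Sum>n. x (n + N)) \<le> cmod (\<Prod>n<M. e (n + N) 0)" by blast
    qed auto
    then have "(1 - (\<Sum>n. x (n + N)))\<^sup>2 \<le> (cmod (?T 0))\<^sup>2" using N by (intro power_mono) auto
    with 1 show ?thesis by simp
  qed
  have tail: "(\<lambda>N. \<Sum>n. x (n + N)) \<longlonglongrightarrow> 0"
    using suminf_exist_split2[OF x(3)] by simp
  have "1 \<le> l2_sq (taylor (\<lambda>z. \<Prod>n. e n z))"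
  proof (rule tendsto_upperbound)
    have "(\<lambda>N. (1 - (\<Sum>n. x (n + N)))\<^sup>2) \<longlonglongrightarrow> (1 - 0)\<^sup>2" by (intro tendsto_intros tail)
    then show "(\<lambda>N. (1 - (\<Sum>n. x (n + N)))\<^sup>2) \<longlonglongrightarrow> 1" by simp
    show "\<forall>\<^sub>F N in sequentially. (1 - (\<Sum>n. x (n + N)))\<^sup>2 \<le> l2_sq (taylor (\<lambda>z. \<Prod>n. e n z))"
      using order_tendstoD(2)[OF tail, of 1] by (auto elim: eventually_mono intro: ge)
  qed simp
  moreover have "l2_sq (taylor (\<lambda>z. \<Prod>n. e n z)) \<le> 1"
    using contractiveD(2)[OF ct[of 0] l2_1] l2_sq_const[of 1] by simp
  ultimately show ?thesis
    unfolding inner_function_def using hol[of 0] le1[of _ 0] by auto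
qed

lemma blaschke_product_inner_function:
  assumes "blaschke_product B" shows "inner_function B"
proof -
  obtain c I a where c: "cmod c = 1" and a: "\<And>n. n \<in> I \<Longrightarrow> cmod (a n) < 1"
    and sm: "(\<lambda>n. 1 - cmod (a n)) summable_on I"
    and B: "\<And>z. z \<in> ball 0 1 \<Longrightarrow> B z = c * (\<Prod>n. if n \<in> I then blaschke_factor (a n) z else 1)"
    using assms unfolding blaschke_product_def by blast
  \<comment> \<open>Indices outside \<open>I\<close> carry the factor 1 and the weight 0, so finite
    and infinite \<open>I\<close> are treated alike.\<close>
  define x where "x n = (if n \<in> I then 1 - cmod (a n) else 0)" for n :: nat
  have x0: "0 \<le> x n" "x n \<le> 1" for n using a[of n] by (auto simp: x_def)
  have "x summable_on UNIV"
    using sm by (rule summable_on_cong_neutral[THEN iffD1, rotated -1]) (auto simp: x_def)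
  then have "summable x" by (rule summable_on_imp_summable)
  have "inner_function (\<lambda>z. \<Prod>n. if n \<in> I then blaschke_factor (a n) z else 1)"
  proof (rule inner_function_prodinf[where x = x])
    show "inner_function (\<lambda>z. if n \<in> I then blaschke_factor (a n) z else 1)" for n
      by (cases "n \<in> I") (auto simp: inner_function_const intro: inner_function_blaschke_factor a)
    show "cmod ((if n \<in> I then blaschke_factor (a n) z else 1) - 1) \<le> x n * (2 / (1 - cmod z))" if "cmod z < 1" for n z
      using blaschke_factor_near_1[OF a that] by (auto simp: x_def)
    show "(if n \<in> I then blaschke_factor (a n) 0 else 1) = complex_of_real (1 - x n)" for n
      by (simp add: x_def blaschke_factor_0)
  qed (use x0 \<open>summable x\<close> in auto)
  from inner_function_mult[OF inner_function_const[OF c] this] show ?thesis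
    by (rule inner_function_cong) (rule B)
qed

section \<open>Model spaces\<close>

lemma hardy_coeff_hx: "hardy_coeff f n = taylor f $ n"
  by (simp add: hardy_coeff_def)

lemma hardy_space_iff: "f \<in> hardy_space \<longleftrightarrow> hol f \<and> l2 (taylor f)"
  by (simp add: hardy_space_def hardy_coeff_hx l2_def)

lemma hardy_norm_sq: "hardy_norm f = sqrt (l2_sq (taylor f))"
  by (simp add: hardy_norm_def hardy_coeff_hx l2_sq_def)

lemma hardy_inner_ip: "hardy_inner f g = l2_inner (taylor f) (taylor g)"
  by (simp add: hardy_inner_def hardy_coeff_hx l2_inner_def)

lemma model_space_iff:
  assumes "hol B"
  shows "f \<in> model_space B \<longleftrightarrow>
    hol f \<and> l2 (taylor f) \<and> (\<forall>g. hol g \<longrightarrow> l2 (taylor g) \<longrightarrow> l2_inner (taylor f) (taylor B * taylor g) = 0)"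
  unfolding model_space_def hardy_inner_ip
  by (auto simp: hardy_space_iff taylor_mult assms)

lemma zero_model_space: "hol B \<Longrightarrow> (\<lambda>z. 0) \<in> model_space B"
  by (simp add: model_space_iff taylor_const l2_inner_def l2_def)

section \<open>The lower bound for the sine\<close>

lemma disc_max_bdd: "bdd_below ((\<lambda>z. max (cmod (f z)) (cmod (g z))) ` A)"
  by (rule bdd_belowI2[where m = 0]) (simp add: le_max_iff_disj)

text \<open>A vector \<open>h\<close> of the first model space is orthogonal to the multiples of
  \<open>B1\<close>, so there \<open>k\<close> pairs like \<open>k - h\<close>, and
  \<open>contractive_adjoint_le\<close> bounds these pairings by the norm of \<open>k - h\<close>.
  Since \<open>k\<close> is orthogonal to the multiples of \<open>B2\<close>,
  \<open>corona_hardy\<close> bounds its unit norm by a multiple of that of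
  \<open>k - h\<close>.\<close>

lemma hardy_sin_ge:
  assumes B: "inner_function B1" "inner_function B2" and d: "\<delta> > 0"
    and ge: "\<delta> \<le> (INF z\<in>ball 0 1. max (cmod (B1 z)) (cmod (B2 z)))"
  shows "hardy_sin (model_space B1) (model_space B2) \<ge> ereal (sqrt (1 / (2 * corona_C \<delta>)))"
  unfolding hardy_sin_def
proof (rule INF_greatest)
  fix k assume "k \<in> {k \<in> model_space B2. hardy_norm k = 1}"
  then have k: "k \<in> model_space B2" and k1: "l2_sq (taylor k) = 1" by (auto simp: hardy_norm_sq)
  have hol: "hol B1" "hol B2" and le: "\<And>z. cmod z < 1 \<Longrightarrow> cmod (B1 z) \<le> 1" "\<And>z. cmod z < 1 \<Longrightarrow> cmod (B2 z) \<le> 1"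
    using B by (auto simp: inner_function_def)
  have kk: "hol k" "l2 (taylor k)" using k by (auto simp: model_space_iff hol)
  have ge': "\<delta> \<le> max (cmod (B1 z)) (cmod (B2 z))" if "cmod z < 1" for z
    using ge cINF_lower[OF disc_max_bdd, of z "ball 0 1" B1 B2] that by force
  have pw: "hol (\<lambda>z. z ^ n)" "l2 (taylor (\<lambda>z. z ^ n))" for n
    by (auto intro!: holomorphic_intros simp: taylor_power l2_X_power)
  have "sqrt (1 / (2 * corona_C \<delta>)) \<le> hardy_setdist k (model_space B1)"
    unfolding hardy_setdist_def
  proof (rule cINF_greatest)
    \<comment> \<open>The bound for a real infimum requires a nonempty set; the zero function
      supplies an element.\<close>
    show "model_space B1 \<noteq> {}" using zero_model_space[OF hol(1)] by auto
    fix h assume h: "h \<in> model_space B1"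
    then have hh: "hol h" "l2 (taylor h)" by (auto simp: model_space_iff hol)
    have "l2_inner (taylor k) (taylor B1 * fps_X ^ n) = l2_inner (taylor k - taylor h) (taylor B1 * fps_X ^ n)" for n
      using h pw[of n] unfolding model_space_iff[OF hol(1)]
      by (auto simp: taylor_power l2_inner_diff_left kk hh contractiveD[OF inner_function_contractive[OF B(1)]])
    then have "(\<Sum>n<N. (cmod (l2_inner (taylor k) (taylor B1 * fps_X ^ n)))\<^sup>2) \<le> l2_sq (taylor k - taylor h)" for N
      using contractive_adjoint_le[OF inner_function_contractive[OF B(1)] l2_diff[OF kk(2) hh(2)], where N = N] by simp
    moreover have "l2_inner (taylor k) (taylor B2 * fps_X ^ n) = 0" for n
      using k pw[of n] unfolding model_space_iff[OF hol(2)] by (auto simp: taylor_power)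
    ultimately have "l2_sq (taylor k) \<le> 2 * corona_C \<delta> * l2_sq (taylor k - taylor h)"
      by (intro corona_hardy[OF hol le ge' d kk(2)])
    then have "1 / (2 * corona_C \<delta>) \<le> l2_sq (taylor k - taylor h)"
      using corona_C_pos[OF d] by (simp add: k1 field_simps)
    then show "sqrt (1 / (2 * corona_C \<delta>)) \<le> hardy_norm (\<lambda>z. k z - h z)"
      by (simp add: hardy_norm_sq taylor_diff kk hh)
  qed
  then show "ereal (sqrt (1 / (2 * corona_C \<delta>))) \<le> ereal (hardy_setdist k (model_space B1))" by simp
qed

section \<open>Nearby vectors from reproducing kernels\<close>

lemma normalized_kernel:
  assumes w: "cmod w < 1"
  obtains k s where "hol k" "l2 (taylor k)" "l2_sq (taylor k) = 1"
    "\<And>g. hol g \<Longrightarrow> l2 (taylor g) \<Longrightarrow> l2_inner (taylor g) (taylor k) = of_real s * g w"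
proof -
  \<comment> \<open>\<open>s\<close> normalizes the Szego kernel at \<open>w\<close>, whose
    coefficient series is \<open>K\<close>; being real, it leaves the inner product without
    conjugation.\<close>
  define s where "s = sqrt (1 - (cmod w)\<^sup>2)"
  define k where "k z = of_real s * (1 / (1 - cnj w * z))" for z
  define K where "K = Abs_fps (\<lambda>n. cnj w ^ n)"
  have w2: "(cmod w)\<^sup>2 < 1" using w by (simp add: power_less_one_iff)
  have s2: "s\<^sup>2 = 1 - (cmod w)\<^sup>2" using w2 by (simp add: s_def)
  have holk: "hol (\<lambda>z. 1 / (1 - cnj w * z))"
    by (intro holomorphic_intros) (use blaschke_denominator_nonzero[OF w] in auto)
  have "taylor (\<lambda>z. 1 / (1 - cnj w * z)) = K"
  proof -
    have "taylor (\<lambda>z. 1 / (1 - cnj w * z)) * taylor (\<lambda>z. 1 - cnj w * z) = taylor (\<lambda>z. 1 / (1 - cnj w * z) * (1 - cnj w * z))"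
      by (intro taylor_mult[symmetric] holk holomorphic_intros)
    also have "\<dots> = taylor (\<lambda>z. 1)"
    proof (rule fps_expansion_cong)
      show "\<forall>\<^sub>F z in nhds 0. 1 / (1 - cnj w * z) * (1 - cnj w * z) = 1"
        using eventually_in_disc by (rule eventually_mono) (use blaschke_denominator_nonzero[OF w] in auto)
    qed
    also have "taylor (\<lambda>z. 1) = K * (1 - fps_const (cnj w) * fps_X)"
    proof (rule fps_ext)
      fix n
      have "K * (1 - fps_const (cnj w) * fps_X) = K - fps_const (cnj w) * (K * fps_X)"
        by (simp add: algebra_simps)
      then show "taylor (\<lambda>z. 1) $ n = (K * (1 - fps_const (cnj w) * fps_X)) $ n"
        by (cases n) (simp_all add: taylor_const fps_X_mult_right_nth K_def)
    qed
    also have "1 - fps_const (cnj w) * fps_X = taylor (\<lambda>z. 1 - cnj w * z)"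
      by (intro fps_expansion_eqI[symmetric] fps_expansion_intros)
    finally have "taylor (\<lambda>z. 1 / (1 - cnj w * z)) * taylor (\<lambda>z. 1 - cnj w * z) = K * taylor (\<lambda>z. 1 - cnj w * z)" .
    moreover have "taylor (\<lambda>z. 1 - cnj w * z) $ 0 = 1" by (simp add: fps_expansion_def)
    then have "taylor (\<lambda>z. 1 - cnj w * z) \<noteq> 0" by auto
    ultimately show ?thesis by simp
  qed
  then have hk: "taylor k = fps_const (of_real s) * K"
    unfolding k_def[abs_def] by (simp only: taylor_cmult[OF holk])
  have "(\<lambda>n. ((cmod w)\<^sup>2) ^ n) sums (1 / (1 - (cmod w)\<^sup>2))"
    by (rule geometric_sums) (use w2 in simp)
  then have Ks: "(\<lambda>n. (cmod (K $ n))\<^sup>2) sums (1 / (1 - (cmod w)\<^sup>2))"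
    by (simp add: K_def norm_power mult.commute flip: power_mult)
  then have lK: "l2 K" and sK: "l2_sq K = 1 / (1 - (cmod w)\<^sup>2)"
    by (auto simp: l2_def l2_sq_def sums_iff)
  show thesis
  proof (rule that[of k s])
    show "hol k" unfolding k_def by (intro holomorphic_intros holk)
    show "l2 (taylor k)" by (simp add: hk l2_cmult lK)
    show "l2_sq (taylor k) = 1" using s2 w2 by (simp add: hk l2_sq_cmult lK sK)
    fix g assume g: "hol g" "l2 (taylor g)"
    have "l2_inner (taylor g) K = g w"
      using taylor_sums[OF g(1) w] by (simp add: l2_inner_def K_def sums_iff)
    then show "l2_inner (taylor g) (taylor k) = of_real s * g w"
      by (simp add: hk l2_inner_cmult_right g lK)
  qed
qed

text \<open>The second inequality is strict at \<open>e = \<epsilon>\<close> because \<open>2 - \<epsilon>\<^sup>2 < 2\<close>.\<close>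

lemma radius_choice:
  assumes "0 < \<epsilon>" "\<epsilon> < (1::real)"
  obtains e where "\<epsilon> < e" "e < 1" "(1 - \<epsilon>\<^sup>2) / (1 - e\<^sup>2) \<le> 2"
    "(1 - \<epsilon>\<^sup>2) / (1 - e\<^sup>2) * (2 * e\<^sup>2 * (2 - \<epsilon>\<^sup>2)) \<le> 4 * \<epsilon>\<^sup>2"
proof -
  have e1: "\<epsilon>\<^sup>2 < 1" "\<epsilon>\<^sup>2 > 0" using assms by (auto simp: power_less_one_iff)
  have l1: "((\<lambda>e. (1 - \<epsilon>\<^sup>2) / (1 - e\<^sup>2)) \<longlongrightarrow> (1 - \<epsilon>\<^sup>2) / (1 - \<epsilon>\<^sup>2)) (at_right \<epsilon>)"
    by (intro tendsto_intros) (use e1 in auto)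
  then have l1': "((\<lambda>e. (1 - \<epsilon>\<^sup>2) / (1 - e\<^sup>2)) \<longlongrightarrow> 1) (at_right \<epsilon>)" using e1 by simp
  have l3: "((\<lambda>e. (1 - \<epsilon>\<^sup>2) / (1 - e\<^sup>2) * (2 * e\<^sup>2 * (2 - \<epsilon>\<^sup>2))) \<longlongrightarrow> 1 * (2 * \<epsilon>\<^sup>2 * (2 - \<epsilon>\<^sup>2))) (at_right \<epsilon>)"
    by (intro tendsto_intros l1')
  have "2 * \<epsilon>\<^sup>2 * (2 - \<epsilon>\<^sup>2) < 2 * \<epsilon>\<^sup>2 * 2" using e1 by (intro mult_strict_left_mono) auto
  then have "\<forall>\<^sub>F e in at_right \<epsilon>. (1 - \<epsilon>\<^sup>2) / (1 - e\<^sup>2) * (2 * e\<^sup>2 * (2 - \<epsilon>\<^sup>2)) < 4 * \<epsilon>\<^sup>2"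
    using order_tendstoD(2)[OF l3, of "4 * \<epsilon>\<^sup>2"] by simp
  moreover have "\<forall>\<^sub>F e in at_right \<epsilon>. (1 - \<epsilon>\<^sup>2) / (1 - e\<^sup>2) < 2"
    using order_tendstoD(2)[OF l1', of 2] by simp
  moreover have "\<forall>\<^sub>F e in at_right \<epsilon>. e \<in> {\<epsilon><..<1}"
    by (rule eventually_at_right_real) (use assms in auto)
  ultimately have "\<forall>\<^sub>F e in at_right \<epsilon>. \<epsilon> < e \<and> e < 1 \<and> (1 - \<epsilon>\<^sup>2) / (1 - e\<^sup>2) \<le> 2 \<and>
      (1 - \<epsilon>\<^sup>2) / (1 - e\<^sup>2) * (2 * e\<^sup>2 * (2 - \<epsilon>\<^sup>2)) \<le> 4 * \<epsilon>\<^sup>2"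
    by eventually_elim auto
  then show thesis
    using eventually_happens'[OF trivial_limit_at_right_real] that by blast
qed

text \<open>An infimum of at most \<open>\<epsilon>\<close> yields a point where both moduli are
  below a slightly larger \<open>e'\<close>. Rescaling by \<open>\<tau>\<close> restores the norms
  of the projected kernels, and the extra factor is paid from the slack in their distance.\<close>

lemma model_space_near_vectors:
  assumes B: "inner_function B1" "inner_function B2" and e: "0 < \<epsilon>" "\<epsilon> < 1"
    and le: "(INF z\<in>ball 0 1. max (cmod (B1 z)) (cmod (B2 z))) \<le> \<epsilon>"
  shows "\<exists>x1\<in>model_space B1. \<exists>x2\<in>model_space B2.
         hardy_norm x1 \<ge> sqrt (1 - \<epsilon>\<^sup>2) \<and> hardy_norm x2 \<ge> sqrt (1 - \<epsilon>\<^sup>2) \<and>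
         hardy_norm (\<lambda>z. x1 z - x2 z) \<le> 2 * \<epsilon>"
proof -
  obtain e' where e': "\<epsilon> < e'" "e' < 1" "(1 - \<epsilon>\<^sup>2) / (1 - e'\<^sup>2) \<le> 2"
    "(1 - \<epsilon>\<^sup>2) / (1 - e'\<^sup>2) * (2 * e'\<^sup>2 * (2 - \<epsilon>\<^sup>2)) \<le> 4 * \<epsilon>\<^sup>2"
    using radius_choice[OF e] .
  have "(INF z\<in>ball 0 1. max (cmod (B1 z)) (cmod (B2 z))) < e'" using le e' by simp
  then obtain w where w: "cmod w < 1" and bw: "cmod (B1 w) < e'" "cmod (B2 w) < e'"
    by (subst (asm) cINF_less_iff) (auto simp: disc_max_bdd)
  obtain k s where k: "hol k" "l2 (taylor k)" "l2_sq (taylor k) = 1"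
    and rep: "\<And>g. hol g \<Longrightarrow> l2 (taylor g) \<Longrightarrow> l2_inner (taylor g) (taylor k) = of_real s * g w"
    using normalized_kernel[OF w] by metis
  have sk: "of_real s * k w = 1" using rep[OF k(1,2)] k by (simp add: l2_inner_self)
  define \<tau> where "\<tau> = sqrt ((1 - \<epsilon>\<^sup>2) / (1 - e'\<^sup>2))"
  have sq1: "\<epsilon>\<^sup>2 < 1" "e'\<^sup>2 < 1" using e e' by (auto simp: power_less_one_iff)
  have t2: "\<tau>\<^sup>2 = (1 - \<epsilon>\<^sup>2) / (1 - e'\<^sup>2)" using sq1 by (simp add: \<tau>_def)
  define u where "u B = fps_const (cnj (B w)) * (taylor B * taylor k)" for B :: "complex \<Rightarrow> complex"
  define x where "x B z = of_real \<tau> * (k z - cnj (B w) * (B z * k z))" for B :: "complex \<Rightarrow> complex" and z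
  have hB: "hol B" "l2 (taylor B * taylor k)" "l2 (u B)" if "inner_function B" for B
    using that contractiveD(1)[OF inner_function_contractive[OF that] k(2)] by (auto simp: inner_function_def u_def l2_cmult)
  have taylor_x: "hol (x B)" "taylor (x B) = fps_const (of_real \<tau>) * (taylor k - u B)" if "inner_function B" for B
  proof -
    have h: "hol (\<lambda>z. B z * k z)" "hol (\<lambda>z. cnj (B w) * (B z * k z))" "hol (\<lambda>z. k z - cnj (B w) * (B z * k z))"
      using hB[OF that] k by (auto intro!: holomorphic_intros)
    show "hol (x B)" unfolding x_def[abs_def] by (intro holomorphic_intros h)
    show "taylor (x B) = fps_const (of_real \<tau>) * (taylor k - u B)"
      unfolding x_def[abs_def] u_def
      by (simp only: taylor_cmult[OF h(3)] taylor_diff[OF k(1) h(2)] taylor_cmult[OF h(1)] taylor_mult[OF hB(1)[OF that] k(1)])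
  qed
  have repB: "l2_inner (taylor B * taylor g) (taylor k) = of_real s * (B w * g w)" if "inner_function B" "hol g" "l2 (taylor g)" for B g
  proof -
    have "l2_inner (taylor (\<lambda>z. B z * g z)) (taylor k) = of_real s * (B w * g w)"
      by (rule rep) (use that hB[of B] contractiveD(1)[OF inner_function_contractive[OF that(1)] that(3)] in \<open>auto intro!: holomorphic_intros simp: taylor_mult\<close>)
    then show ?thesis using that hB[of B] by (simp add: taylor_mult)
  qed
  have mem: "x B \<in> model_space B" if b: "inner_function B" for B
    unfolding model_space_iff[OF hB(1)[OF b]]
  proof (intro conjI allI impI)
    show "hol (x B)" "l2 (taylor (x B))" using taylor_x[OF b] hB[OF b] k by (auto simp: l2_cmult l2_diff)
    fix g assume g: "hol g" "l2 (taylor g)"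
    have Bg: "l2 (taylor B * taylor g)" using contractiveD(1)[OF inner_function_contractive[OF b] g(2)] .
    have "l2_inner (taylor k) (taylor B * taylor g) = cnj (of_real s * (B w * g w))"
      using l2_inner_cnj[OF Bg k(2)] repB[OF b g] by simp
    moreover have "l2_inner (u B) (taylor B * taylor g) = cnj (B w) * cnj (of_real s * g w)"
      unfolding u_def using l2_inner_cnj[OF g(2) k(2)] rep[OF g]
      by (simp add: l2_inner_cmult_left hB[OF b] Bg inner_function_l2_inner[OF b k(2) g(2)])
    ultimately have "l2_inner (taylor k - u B) (taylor B * taylor g) = 0"
      by (simp add: l2_inner_diff_left k hB[OF b] Bg)
    then show "l2_inner (taylor (x B)) (taylor B * taylor g) = 0"
      by (simp add: taylor_x[OF b] l2_inner_cmult_left l2_diff k hB[OF b] Bg)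
  qed
  have squ: "l2_sq (u B) = (cmod (B w))\<^sup>2" if b: "inner_function B" for B
    by (simp add: u_def l2_sq_cmult hB[OF b] inner_function_l2_sq[OF b k(2)] k)
  have ipu: "l2_inner (taylor k) (u B) = of_real ((cmod (B w))\<^sup>2)" if b: "inner_function B" for B
  proof -
    have "l2_inner (taylor k) (taylor B * taylor k) = cnj (of_real s * (B w * k w))"
      using l2_inner_cnj[OF hB(2)[OF b] k(2)] repB[OF b k(1,2)] by simp
    also have "of_real s * (B w * k w) = B w" using sk by (metis mult.left_commute mult.right_neutral)
    finally show ?thesis
      unfolding u_def of_real_cmod_squared by (simp add: l2_inner_cmult_right k hB[OF b])
  qed
  have nrm: "sqrt (1 - \<epsilon>\<^sup>2) \<le> hardy_norm (x B)" if b: "inner_function B" and c: "cmod (B w) < e'" for B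
  proof -
    have "l2_sq (taylor k - u B) = 1 - (cmod (B w))\<^sup>2"
      by (simp add: l2_sq_diff k hB[OF b] squ[OF b] ipu[OF b] del: of_real_power)
    then have "l2_sq (taylor (x B)) = \<tau>\<^sup>2 * (1 - (cmod (B w))\<^sup>2)"
      by (simp add: taylor_x[OF b] l2_sq_cmult l2_diff k hB[OF b])
    also have "\<dots> \<ge> \<tau>\<^sup>2 * (1 - e'\<^sup>2)"
      by (intro mult_left_mono diff_left_mono power_mono) (use c in auto)
    finally have "1 - \<epsilon>\<^sup>2 \<le> l2_sq (taylor (x B))" using sq1 by (simp add: t2)
    then show ?thesis by (simp add: hardy_norm_sq)
  qed
  define \<sigma> where "\<sigma> = (cmod (B1 w))\<^sup>2 + (cmod (B2 w))\<^sup>2"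
  have s0: "\<sigma> \<ge> 0" by (simp add: \<sigma>_def)
  have "(cmod (B1 w))\<^sup>2 \<le> e'\<^sup>2" "(cmod (B2 w))\<^sup>2 \<le> e'\<^sup>2" using bw by (auto intro: power_mono)
  then have s1: "\<sigma> \<le> 2 * e'\<^sup>2" by (simp add: \<sigma>_def)
  note lu = hB(3)[OF B(1)] hB(3)[OF B(2)]
  \<comment> \<open>\<open>\<sigma>\<close> is the component of \<open>u B1 + u B2\<close> along the
    unit vector \<open>k\<close>.\<close>
  have "\<sigma>\<^sup>2 \<le> l2_sq (u B1 + u B2)"
  proof -
    have "0 \<le> l2_sq ((u B1 + u B2) - fps_const (of_real \<sigma>) * taylor k)"
      by (intro l2_sq_nonneg l2_diff l2_add l2_cmult lu k)
    also have "\<dots> = l2_sq (u B1 + u B2) + \<sigma>\<^sup>2 - 2 * Re (l2_inner (u B1 + u B2) (fps_const (of_real \<sigma>) * taylor k))"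
      by (simp add: l2_sq_diff l2_add l2_cmult lu k l2_sq_cmult)
    also have "l2_inner (u B1 + u B2) (fps_const (of_real \<sigma>) * taylor k) = of_real (\<sigma> * \<sigma>)"
      using l2_inner_cnj[OF k(2) lu(1)] l2_inner_cnj[OF k(2) lu(2)]
      by (simp add: l2_inner_cmult_right l2_inner_add_left l2_add lu k ipu B \<sigma>_def)
    finally show ?thesis by (simp add: power2_eq_square)
  qed
  \<comment> \<open>The parallelogram law turns the lower bound for the sum into an upper bound for
    the difference.\<close>
  moreover have "l2_sq (u B1 - u B2) + l2_sq (u B1 + u B2) = 2 * \<sigma>"
    by (simp add: l2_sq_diff l2_sq_add lu squ B \<sigma>_def)
  ultimately have su: "l2_sq (u B1 - u B2) \<le> \<sigma> * (2 - \<sigma>)" by (simp add: power2_eq_square algebra_simps)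
  have "\<tau>\<^sup>2 * (\<sigma> * (2 - \<sigma>)) \<le> 4 * \<epsilon>\<^sup>2"
  \<comment> \<open>For small \<open>\<sigma>\<close> the bound 2 on the squared scaling factor
    suffices. Otherwise \<open>2 - \<sigma>\<close> is below \<open>2 - \<epsilon>\<^sup>2\<close>,
    and the last property of \<open>e'\<close> applies.\<close>
  proof (cases "\<sigma> \<le> \<epsilon>\<^sup>2")
    case True
    have "\<sigma> * (2 - \<sigma>) \<le> \<epsilon>\<^sup>2 * 2" by (intro mult_mono) (use True s0 sq1 in auto)
    then have "\<tau>\<^sup>2 * (\<sigma> * (2 - \<sigma>)) \<le> \<tau>\<^sup>2 * (\<epsilon>\<^sup>2 * 2)" by (intro mult_left_mono) auto
    also have "\<dots> \<le> 2 * (\<epsilon>\<^sup>2 * 2)" by (intro mult_right_mono) (use e' t2 in auto)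
    finally show ?thesis by simp
  next
    case False
    have "\<sigma> * (2 - \<sigma>) \<le> 2 * e'\<^sup>2 * (2 - \<epsilon>\<^sup>2)" by (intro mult_mono) (use False s0 s1 sq1 in auto)
    then have "\<tau>\<^sup>2 * (\<sigma> * (2 - \<sigma>)) \<le> \<tau>\<^sup>2 * (2 * e'\<^sup>2 * (2 - \<epsilon>\<^sup>2))" by (intro mult_left_mono) auto
    then show ?thesis using e'(4) by (simp add: t2)
  qed
  have "taylor (\<lambda>z. x B1 z - x B2 z) = - (fps_const (of_real \<tau>) * (u B1 - u B2))"
    by (simp add: taylor_diff taylor_x B algebra_simps)
  then have "l2_sq (taylor (\<lambda>z. x B1 z - x B2 z)) = \<tau>\<^sup>2 * l2_sq (u B1 - u B2)"
    by (simp add: l2_sq_uminus l2_sq_cmult l2_diff lu)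
  also have "\<dots> \<le> \<tau>\<^sup>2 * (\<sigma> * (2 - \<sigma>))" by (intro mult_left_mono su) auto
  also have "\<dots> \<le> (2 * \<epsilon>)\<^sup>2" using \<open>\<tau>\<^sup>2 * (\<sigma> * (2 - \<sigma>)) \<le> 4 * \<epsilon>\<^sup>2\<close> by (simp add: power_mult_distrib)
  finally have "hardy_norm (\<lambda>z. x B1 z - x B2 z) \<le> 2 * \<epsilon>"
    unfolding hardy_norm_sq using e by (intro real_le_lsqrt) auto
  then show ?thesis using mem[OF B(1)] mem[OF B(2)] nrm[OF B(1) bw(1)] nrm[OF B(2) bw(2)] by blast
qed

theorem theorem5p6:
  "(\<forall>(B\<^sub>1::complex \<Rightarrow> complex) (B\<^sub>2::complex \<Rightarrow> complex) (\<epsilon>::real).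
      blaschke_product B\<^sub>1 \<longrightarrow> blaschke_product B\<^sub>2 \<longrightarrow> 0 < \<epsilon> \<longrightarrow> \<epsilon> < 1 \<longrightarrow>
      (INF z\<in>ball 0 1. max (cmod (B\<^sub>1 z)) (cmod (B\<^sub>2 z))) \<le> \<epsilon> \<longrightarrow>
      (\<exists>x\<^sub>1\<in>model_space B\<^sub>1. \<exists>x\<^sub>2\<in>model_space B\<^sub>2.
         hardy_norm x\<^sub>1 \<ge> sqrt (1 - \<epsilon>\<^sup>2) \<and> hardy_norm x\<^sub>2 \<ge> sqrt (1 - \<epsilon>\<^sup>2) \<and>
         hardy_norm (\<lambda>z. x\<^sub>1 z - x\<^sub>2 z) \<le> 2 * \<epsilon>)) \<and>
   (\<forall>\<delta>::real. \<delta> > 0 \<longrightarrow>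
      (\<exists>c\<^sub>\<delta>::real. c\<^sub>\<delta> > 0 \<and>
         (\<forall>(B\<^sub>1::complex \<Rightarrow> complex) (B\<^sub>2::complex \<Rightarrow> complex).
            blaschke_product B\<^sub>1 \<longrightarrow> blaschke_product B\<^sub>2 \<longrightarrow>
            (INF z\<in>ball 0 1. max (cmod (B\<^sub>1 z)) (cmod (B\<^sub>2 z))) \<ge> \<delta> \<longrightarrow>
            hardy_sin (model_space B\<^sub>1) (model_space B\<^sub>2) > ereal c\<^sub>\<delta>)))"
proof (intro conjI allI impI)
  fix B1 B2 :: "complex \<Rightarrow> complex" and \<epsilon> :: real
  assume "blaschke_product B1" "blaschke_product B2" "0 < \<epsilon>" "\<epsilon> < 1"
    "(INF z\<in>ball 0 1. max (cmod (B1 z)) (cmod (B2 z))) \<le> \<epsilon>"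
  then show "\<exists>x1\<in>model_space B1. \<exists>x2\<in>model_space B2.
         hardy_norm x1 \<ge> sqrt (1 - \<epsilon>\<^sup>2) \<and> hardy_norm x2 \<ge> sqrt (1 - \<epsilon>\<^sup>2) \<and>
         hardy_norm (\<lambda>z. x1 z - x2 z) \<le> 2 * \<epsilon>"
    by (intro model_space_near_vectors blaschke_product_inner_function)
next
  fix \<delta> :: real assume d: "\<delta> > 0"
  define c where "c = sqrt (1 / (2 * corona_C \<delta>))"
  have c: "c > 0" using corona_C_pos[OF d] by (simp add: c_def)
  show "\<exists>c. c > 0 \<and> (\<forall>B1 B2. blaschke_product B1 \<longrightarrow> blaschke_product B2 \<longrightarrow>
            (INF z\<in>ball 0 1. max (cmod (B1 z)) (cmod (B2 z))) \<ge> \<delta> \<longrightarrow>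
            hardy_sin (model_space B1) (model_space B2) > ereal c)"
  \<comment> \<open>Halving \<open>c\<close> makes the inequality strict.\<close>
  proof (intro exI[of _ "c / 2"] conjI allI impI)
    show "c / 2 > 0" using c by simp
    fix B1 B2 :: "complex \<Rightarrow> complex"
    assume "blaschke_product B1" "blaschke_product B2"
      "(INF z\<in>ball 0 1. max (cmod (B1 z)) (cmod (B2 z))) \<ge> \<delta>"
    then have "ereal c \<le> hardy_sin (model_space B1) (model_space B2)"
      unfolding c_def by (intro hardy_sin_ge blaschke_product_inner_function d)
    moreover have "ereal (c / 2) < ereal c" using c by simp
    ultimately show "hardy_sin (model_space B1) (model_space B2) > ereal (c / 2)"
      by (rule less_le_trans[rotated])
  qed
qed

end
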